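(* Every sequent provable in $\mathsf{RTC}_{G}$ is provable in $\mathsf{CRTC}^{\omega}_{G}$ (i.e. $\mathsf{CRTC}^{\omega}_{G}\supseteq\mathsf{RTC}_{G}$); consequently $\mathsf{CRTC}^{\omega}_{G}$ is complete with respect to Henkin semantics, i.e. every sequent valid in all Henkin structures is provable in $\mathsf{CRTC}^{\omega}_{G}$.
   Context: Formulas of $\mathcal{L}_{\mathsf{RTC}}$: first-order formulas with equality extended by $(RTC_{x,y}\,\varphi)(s,t)$ for distinct variables $x,y$ bound in $\varphi$ and terms $s,t$. Henkin semantics: a frame is $\langle D,I,\mathcal{D}\rangle$ with $\langle D,I\rangle$ a first-order structure and $\mathcal{D}\subseteq\wp(D)$; formulas are interpreted as usual except $M,v\models(RTC_{x,y}\varphi)(s,t)$ iff for every $A\in\mathcal{D}$, if $v(s)\in A$ and for all $a,b\in D$, $a\in A$ and $M,v[x:=a,y:=b]\models\varphi$ imply $b\in A$, then $v(t)\in A$. A Henkin structure is a frame with $\{a\in D\mid M,v[x:=a]\models\varphi\}\in\mathcal{D}$ for every formula $\varphi$, variable $x$ and valuation $v$. A sequent $\Gamma\Rightarrow\Delta$ is Henkin-valid if in every Henkin structure and valuation satisfying all of $\Gamma$ some formula of $\Delta$ holds. $\mathcal{LK}_=$: classical sequent calculus with axiom $\varphi\Rightarrow\varphi$, weakening, usual connective/quantifier rules (eigenvariable conditions), $(=L_1)$: from $\Gamma\Rightarrow\varphi[s/x],\Delta$ infer $\Gamma,s=t\Rightarrow\varphi[t/x],\Delta$, $(=L_2)$: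 from $\Gamma\Rightarrow\varphi[t/x],\Delta$ infer $\Gamma,s=t\Rightarrow\varphi[s/x],\Delta$, $(=R)$: $\Rightarrow t=t$, Cut, and (Subst): from $\Gamma\Rightarrow\Delta$ infer $\Gamma\theta\Rightarrow\Delta\theta$. Rules: (Refl) $\Gamma\Rightarrow\Delta,(RTC_{x,y}\varphi)(s,s)$; (Trans) from $\Gamma\Rightarrow\Delta,(RTC_{x,y}\varphi)(s,r)$ and $\Gamma\Rightarrow\Delta,\varphi[r/x,t/y]$ infer $\Gamma\Rightarrow\Delta,(RTC_{x,y}\varphi)(s,t)$; (Ind) from $\Gamma,\psi(x),\varphi(x,y)\Rightarrow\Delta,\psi[y/x]$ infer $\Gamma,\psi[s/x],(RTC_{x,y}\varphi)(s,t)\Rightarrow\Delta,\psi[t/x]$ with $x\notin fv(\Gamma,\Delta)$, $y\notin fv(\Gamma,\Delta,\psi)$; (Case) from $\Gamma,s=t\Rightarrow\Delta$ and $\Gamma,(RTC_{x,y}\varphi)(s,z),\varphi[z/x,t/y]\Rightarrow\Delta$ infer $\Gamma,(RTC_{x,y}\varphi)(s,t)\Rightarrow\Delta$, $z$ fresh, where $(RTC_{x,y}\varphi)(s,z)$ is the immediate ancestor of the principal formula. $\mathsf{RTC}_G$ = $\mathcal{LK}_=$ + (Refl), (Trans), (Ind), with finite derivation trees as proofs. $\mathsf{RTC}^{\omega}_G$ = $\mathcal{LK}_=$ + (Refl), (Trans), (Case); a pre-proof is a possibly infinite derivation tree with no open leaves; a trace pair $(\tau,\tau')$ between $RTC$-formulas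 in the antecedents of a conclusion and a premise holds if the rule is (Subst) with $\tau=\tau'\theta$, or the rule is (Case) and $\tau$ is principal and $\tau'$ its immediate ancestor (progressing), or $\tau=\tau'$ otherwise; a trace follows a path if from some offset consecutive formulas are trace pairs along it; a proof is a pre-proof in which every infinite path is followed by a trace with infinitely many progressing pairs. $\mathsf{CRTC}^{\omega}_G$ consists of the finite and regular (finitely many distinct subtrees) $\mathsf{RTC}^{\omega}_G$ proofs. *)

theory Defs
  imports Main
begin

section \<open>Syntax\<close>

text \<open>
  Formulas are taken up to renaming of bound variables, via de Bruijn indices; index \<open>n\<close> outside
  all binders is the \<open>n\<close>-th free variable. A signature is a set of function symbols and a set of
  predicate symbols, each symbol paired with its arity.
\<close>

record ('f, 'p) signature =
  funs :: "('f \<times> nat) set"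
  preds :: "('p \<times> nat) set"

datatype 'f tm = Var nat | Fun 'f "'f tm list"

text \<open>
  In \<open>RTC \<phi> s t\<close>, which renders \<open>(RTC\<^bsub>x,y\<^esub> \<phi>)(s,t)\<close>, the operator binds two variables of \<open>\<phi>\<close>:
  index 0 is \<open>x\<close> and index 1 is \<open>y\<close>. The terms \<open>s\<close> and \<open>t\<close> lie outside its scope.
\<close>

datatype ('f, 'p) fm =
    Eq "'f tm" "'f tm"
  | Pred 'p "'f tm list"
  | Neg "('f, 'p) fm"
  | Con "('f, 'p) fm" "('f, 'p) fm"
  | Dis "('f, 'p) fm" "('f, 'p) fm"
  | Imp "('f, 'p) fm" "('f, 'p) fm"
  | Uni "('f, 'p) fm"
  | Exi "('f, 'p) fm"
  | is_RTC: RTC "('f, 'p) fm" "'f tm" "'f tm"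

fun wf_tm :: "('f, 'p) signature \<Rightarrow> 'f tm \<Rightarrow> bool" where
  "wf_tm \<Sigma> (Var n) = True"
| "wf_tm \<Sigma> (Fun f ts) = ((f, length ts) \<in> funs \<Sigma> \<and> (\<forall>t\<in>set ts. wf_tm \<Sigma> t))"

fun wf_fm :: "('f, 'p) signature \<Rightarrow> ('f, 'p) fm \<Rightarrow> bool" where
  "wf_fm \<Sigma> (Eq s t) = (wf_tm \<Sigma> s \<and> wf_tm \<Sigma> t)"
| "wf_fm \<Sigma> (Pred p ts) = ((p, length ts) \<in> preds \<Sigma> \<and> (\<forall>t\<in>set ts. wf_tm \<Sigma> t))"
| "wf_fm \<Sigma> (Neg \<phi>) = wf_fm \<Sigma> \<phi>"
| "wf_fm \<Sigma> (Con \<phi> \<psi>) = (wf_fm \<Sigma> \<phi> \<and> wf_fm \<Sigma> \<psi>)"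
| "wf_fm \<Sigma> (Dis \<phi> \<psi>) = (wf_fm \<Sigma> \<phi> \<and> wf_fm \<Sigma> \<psi>)"
| "wf_fm \<Sigma> (Imp \<phi> \<psi>) = (wf_fm \<Sigma> \<phi> \<and> wf_fm \<Sigma> \<psi>)"
| "wf_fm \<Sigma> (Uni \<phi>) = wf_fm \<Sigma> \<phi>"
| "wf_fm \<Sigma> (Exi \<phi>) = wf_fm \<Sigma> \<phi>"
| "wf_fm \<Sigma> (RTC \<phi> s t) = (wf_fm \<Sigma> \<phi> \<and> wf_tm \<Sigma> s \<and> wf_tm \<Sigma> t)"

fun fv_tm :: "'f tm \<Rightarrow> nat set" where
  "fv_tm (Var n) = {n}"
| "fv_tm (Fun f ts) = (\<Union>t\<in>set ts. fv_tm t)"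

fun fv :: "('f, 'p) fm \<Rightarrow> nat set" where
  "fv (Eq s t) = fv_tm s \<union> fv_tm t"
| "fv (Pred p ts) = (\<Union>t\<in>set ts. fv_tm t)"
| "fv (Neg \<phi>) = fv \<phi>"
| "fv (Con \<phi> \<psi>) = fv \<phi> \<union> fv \<psi>"
| "fv (Dis \<phi> \<psi>) = fv \<phi> \<union> fv \<psi>"
| "fv (Imp \<phi> \<psi>) = fv \<phi> \<union> fv \<psi>"
| "fv (Uni \<phi>) = {n. Suc n \<in> fv \<phi>}"
| "fv (Exi \<phi>) = {n. Suc n \<in> fv \<phi>}"
| "fv (RTC \<phi> s t) = {n. Suc (Suc n) \<in> fv \<phi>} \<union> fv_tm s \<union> fv_tm t"

definition fvs :: "('f, 'p) fm set \<Rightarrow> nat set" where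
  "fvs \<Gamma> = (\<Union>\<phi>\<in>\<Gamma>. fv \<phi>)"

fun subst_tm :: "(nat \<Rightarrow> 'f tm) \<Rightarrow> 'f tm \<Rightarrow> 'f tm" where
  "subst_tm \<theta> (Var n) = \<theta> n"
| "subst_tm \<theta> (Fun f ts) = Fun f (map (subst_tm \<theta>) ts)"

definition up :: "(nat \<Rightarrow> 'f tm) \<Rightarrow> nat \<Rightarrow> 'f tm" where
  "up \<theta> = case_nat (Var 0) (\<lambda>n. subst_tm (\<lambda>k. Var (Suc k)) (\<theta> n))"

fun subst :: "(nat \<Rightarrow> 'f tm) \<Rightarrow> ('f, 'p) fm \<Rightarrow> ('f, 'p) fm" where
  "subst \<theta> (Eq s t) = Eq (subst_tm \<theta> s) (subst_tm \<theta> t)"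
| "subst \<theta> (Pred p ts) = Pred p (map (subst_tm \<theta>) ts)"
| "subst \<theta> (Neg \<phi>) = Neg (subst \<theta> \<phi>)"
| "subst \<theta> (Con \<phi> \<psi>) = Con (subst \<theta> \<phi>) (subst \<theta> \<psi>)"
| "subst \<theta> (Dis \<phi> \<psi>) = Dis (subst \<theta> \<phi>) (subst \<theta> \<psi>)"
| "subst \<theta> (Imp \<phi> \<psi>) = Imp (subst \<theta> \<phi>) (subst \<theta> \<psi>)"
| "subst \<theta> (Uni \<phi>) = Uni (subst (up \<theta>) \<phi>)"
| "subst \<theta> (Exi \<phi>) = Exi (subst (up \<theta>) \<phi>)"
| "subst \<theta> (RTC \<phi> s t) = RTC (subst (up (up \<theta>)) \<phi>) (subst_tm \<theta> s) (subst_tm \<theta> t)"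

text \<open>
  Instantiation of the body of a binder: \<open>inst \<phi> t\<close> is \<open>\<phi>[t/x]\<close> for the variable \<open>x\<close> at index 0, and
  \<open>inst2 \<phi> s t\<close> is the simultaneous \<open>\<phi>[s/x, t/y]\<close> for \<open>x\<close> at index 0 and \<open>y\<close> at index 1. The other
  indices of the body are shifted back so that they denote free variables again.
\<close>

definition inst :: "('f, 'p) fm \<Rightarrow> 'f tm \<Rightarrow> ('f, 'p) fm" where
  "inst \<phi> t = subst (case_nat t Var) \<phi>"

definition inst2 :: "('f, 'p) fm \<Rightarrow> 'f tm \<Rightarrow> 'f tm \<Rightarrow> ('f, 'p) fm" where
  "inst2 \<phi> s t = subst (case_nat s (case_nat t Var)) \<phi>"


section \<open>Henkin semantics\<close>

record ('f, 'p, 'd) frame =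
  carrier :: "'d set"
  fint :: "'f \<Rightarrow> 'd list \<Rightarrow> 'd"
  pint :: "'p \<Rightarrow> 'd list \<Rightarrow> bool"
  admissible :: "'d set set"

definition is_frame :: "('f, 'p) signature \<Rightarrow> ('f, 'p, 'd) frame \<Rightarrow> bool" where
  "is_frame \<Sigma> M \<longleftrightarrow>
     carrier M \<noteq> {} \<and>
     (\<forall>(f, n)\<in>funs \<Sigma>. \<forall>as. length as = n \<and> set as \<subseteq> carrier M \<longrightarrow> fint M f as \<in> carrier M) \<and>
     admissible M \<subseteq> Pow (carrier M)"

definition valuation :: "('f, 'p, 'd) frame \<Rightarrow> (nat \<Rightarrow> 'd) \<Rightarrow> bool" where
  "valuation M v \<longleftrightarrow> range v \<subseteq> carrier M"

fun eval :: "('f, 'p, 'd) frame \<Rightarrow> (nat \<Rightarrow> 'd) \<Rightarrow> 'f tm \<Rightarrow> 'd" where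
  "eval M v (Var n) = v n"
| "eval M v (Fun f ts) = fint M f (map (eval M v) ts)"

fun sat :: "('f, 'p, 'd) frame \<Rightarrow> (nat \<Rightarrow> 'd) \<Rightarrow> ('f, 'p) fm \<Rightarrow> bool" where
  "sat M v (Eq s t) \<longleftrightarrow> eval M v s = eval M v t"
| "sat M v (Pred p ts) \<longleftrightarrow> pint M p (map (eval M v) ts)"
| "sat M v (Neg \<phi>) \<longleftrightarrow> \<not> sat M v \<phi>"
| "sat M v (Con \<phi> \<psi>) \<longleftrightarrow> sat M v \<phi> \<and> sat M v \<psi>"
| "sat M v (Dis \<phi> \<psi>) \<longleftrightarrow> sat M v \<phi> \<or> sat M v \<psi>"
| "sat M v (Imp \<phi> \<psi>) \<longleftrightarrow> (sat M v \<phi> \<longrightarrow> sat M v \<psi>)"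
| "sat M v (Uni \<phi>) \<longleftrightarrow> (\<forall>a\<in>carrier M. sat M (case_nat a v) \<phi>)"
| "sat M v (Exi \<phi>) \<longleftrightarrow> (\<exists>a\<in>carrier M. sat M (case_nat a v) \<phi>)"
| "sat M v (RTC \<phi> s t) \<longleftrightarrow>
     (\<forall>A\<in>admissible M.
        eval M v s \<in> A \<and>
        (\<forall>a\<in>carrier M. \<forall>b\<in>carrier M.
           a \<in> A \<and> sat M (case_nat a (case_nat b v)) \<phi> \<longrightarrow> b \<in> A) \<longrightarrow>
        eval M v t \<in> A)"

definition henkin_structure :: "('f, 'p) signature \<Rightarrow> ('f, 'p, 'd) frame \<Rightarrow> bool" where
  "henkin_structure \<Sigma> M \<longleftrightarrow>
     is_frame \<Sigma> M \<and>
     (\<forall>\<phi> x v. wf_fm \<Sigma> \<phi> \<longrightarrow> valuation M v \<longrightarrow>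
        {a \<in> carrier M. sat M (v(x := a)) \<phi>} \<in> admissible M)"


section \<open>Sequents\<close>

datatype ('f, 'p) sequent =
  Sequent (ant: "('f, 'p) fm set") (suc: "('f, 'p) fm set") (infix "\<turnstile>" 45)

definition wf_seq :: "('f, 'p) signature \<Rightarrow> ('f, 'p) sequent \<Rightarrow> bool" where
  "wf_seq \<Sigma> S \<longleftrightarrow>
     finite (ant S) \<and> finite (suc S) \<and> (\<forall>\<phi>\<in>ant S \<union> suc S. wf_fm \<Sigma> \<phi>)"

text \<open>
  HOL cannot quantify over types inside a formula, so validity refers to the Henkin structures whose
  carrier is a nonempty subset of a given type \<open>'d\<close>.
\<close>

definition henkin_valid :: "'d itself \<Rightarrow> ('f, 'p) signature \<Rightarrow> ('f, 'p) sequent \<Rightarrow> bool" where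
  "henkin_valid _ \<Sigma> S \<longleftrightarrow>
     (\<forall>(M :: ('f, 'p, 'd) frame) v. henkin_structure \<Sigma> M \<longrightarrow> valuation M v \<longrightarrow>
        (\<forall>\<phi>\<in>ant S. sat M v \<phi>) \<longrightarrow> (\<exists>\<phi>\<in>suc S. sat M v \<phi>))"


section \<open>Proof systems\<close>

text \<open>
  The rules of LK with equality other than (Subst), together with (Refl) and (Trans), as a relation
  between the list of premises and the conclusion. Sequents are pairs of sets, hence \<open>insert \<phi> \<Gamma>\<close>
  renders \<open>\<Gamma>, \<phi>\<close> and contraction is implicit.
\<close>

inductive base_rule :: "('f, 'p) sequent list \<Rightarrow> ('f, 'p) sequent \<Rightarrow> bool" where
  Ax: "base_rule [] ({\<phi>} \<turnstile> {\<phi>})"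
| Weak: "\<Gamma> \<subseteq> \<Gamma>' \<Longrightarrow> \<Delta> \<subseteq> \<Delta>' \<Longrightarrow> base_rule [\<Gamma> \<turnstile> \<Delta>] (\<Gamma>' \<turnstile> \<Delta>')"
| Cut: "base_rule [\<Gamma> \<turnstile> insert \<phi> \<Delta>, insert \<phi> \<Gamma>' \<turnstile> \<Delta>'] (\<Gamma> \<union> \<Gamma>' \<turnstile> \<Delta> \<union> \<Delta>')"
| NegL: "base_rule [\<Gamma> \<turnstile> insert \<phi> \<Delta>] (insert (Neg \<phi>) \<Gamma> \<turnstile> \<Delta>)"
| NegR: "base_rule [insert \<phi> \<Gamma> \<turnstile> \<Delta>] (\<Gamma> \<turnstile> insert (Neg \<phi>) \<Delta>)"
| ConL: "base_rule [insert \<phi> (insert \<psi> \<Gamma>) \<turnstile> \<Delta>] (insert (Con \<phi> \<psi>) \<Gamma> \<turnstile> \<Delta>)"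
| ConR: "base_rule [\<Gamma> \<turnstile> insert \<phi> \<Delta>, \<Gamma> \<turnstile> insert \<psi> \<Delta>] (\<Gamma> \<turnstile> insert (Con \<phi> \<psi>) \<Delta>)"
| DisL: "base_rule [insert \<phi> \<Gamma> \<turnstile> \<Delta>, insert \<psi> \<Gamma> \<turnstile> \<Delta>] (insert (Dis \<phi> \<psi>) \<Gamma> \<turnstile> \<Delta>)"
| DisR: "base_rule [\<Gamma> \<turnstile> insert \<phi> (insert \<psi> \<Delta>)] (\<Gamma> \<turnstile> insert (Dis \<phi> \<psi>) \<Delta>)"
| ImpL: "base_rule [\<Gamma> \<turnstile> insert \<phi> \<Delta>, insert \<psi> \<Gamma> \<turnstile> \<Delta>] (insert (Imp \<phi> \<psi>) \<Gamma> \<turnstile> \<Delta>)"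
| ImpR: "base_rule [insert \<phi> \<Gamma> \<turnstile> insert \<psi> \<Delta>] (\<Gamma> \<turnstile> insert (Imp \<phi> \<psi>) \<Delta>)"
| AllL: "base_rule [insert (inst \<phi> t) \<Gamma> \<turnstile> \<Delta>] (insert (Uni \<phi>) \<Gamma> \<turnstile> \<Delta>)"
| AllR: "y \<notin> fvs \<Gamma> \<union> fvs \<Delta> \<union> fv (Uni \<phi>) \<Longrightarrow>
    base_rule [\<Gamma> \<turnstile> insert (inst \<phi> (Var y)) \<Delta>] (\<Gamma> \<turnstile> insert (Uni \<phi>) \<Delta>)"
| ExiL: "y \<notin> fvs \<Gamma> \<union> fvs \<Delta> \<union> fv (Exi \<phi>) \<Longrightarrow>
    base_rule [insert (inst \<phi> (Var y)) \<Gamma> \<turnstile> \<Delta>] (insert (Exi \<phi>) \<Gamma> \<turnstile> \<Delta>)"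
| ExiR: "base_rule [\<Gamma> \<turnstile> insert (inst \<phi> t) \<Delta>] (\<Gamma> \<turnstile> insert (Exi \<phi>) \<Delta>)"
| EqL1: "base_rule [\<Gamma> \<turnstile> insert (inst \<phi> s) \<Delta>] (insert (Eq s t) \<Gamma> \<turnstile> insert (inst \<phi> t) \<Delta>)"
| EqL2: "base_rule [\<Gamma> \<turnstile> insert (inst \<phi> t) \<Delta>] (insert (Eq s t) \<Gamma> \<turnstile> insert (inst \<phi> s) \<Delta>)"
| EqR: "base_rule [] ({} \<turnstile> {Eq t t})"
| Refl: "base_rule [] (\<Gamma> \<turnstile> insert (RTC \<phi> s s) \<Delta>)"
| Trans: "base_rule [\<Gamma> \<turnstile> insert (RTC \<phi> s r) \<Delta>, \<Gamma> \<turnstile> insert (inst2 \<phi> r t) \<Delta>]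
    (\<Gamma> \<turnstile> insert (RTC \<phi> s t) \<Delta>)"

text \<open>
  In (Ind) the formula \<open>\<psi>\<close> has its induction variable at index 0, so \<open>\<psi>[s/x]\<close> is \<open>inst \<psi> s\<close>. The
  variables \<open>x\<close> and \<open>y\<close> of the premise are free variables there; as they are bound in the RTC formula
  (and \<open>x\<close> is abstracted in \<open>\<psi>\<close>), they must not be free in the respective bodies. They may occur in
  \<open>s\<close> and \<open>t\<close>.
\<close>

inductive RTC_G :: "('f, 'p) signature \<Rightarrow> ('f, 'p) sequent \<Rightarrow> bool"
  for \<Sigma> :: "('f, 'p) signature" where
  Base: "base_rule Ps S \<Longrightarrow> (\<forall>P\<in>set Ps. RTC_G \<Sigma> P) \<Longrightarrow> wf_seq \<Sigma> S \<Longrightarrow> RTC_G \<Sigma> S"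
| Subst: "RTC_G \<Sigma> (\<Gamma> \<turnstile> \<Delta>) \<Longrightarrow> wf_seq \<Sigma> (subst \<theta> ` \<Gamma> \<turnstile> subst \<theta> ` \<Delta>) \<Longrightarrow>
    RTC_G \<Sigma> (subst \<theta> ` \<Gamma> \<turnstile> subst \<theta> ` \<Delta>)"
| Ind: "RTC_G \<Sigma> (insert (inst \<psi> (Var x)) (insert (inst2 \<phi> (Var x) (Var y)) \<Gamma>)
              \<turnstile> insert (inst \<psi> (Var y)) \<Delta>) \<Longrightarrow>
    x \<noteq> y \<Longrightarrow>
    x \<notin> fvs \<Gamma> \<union> fvs \<Delta> \<Longrightarrow> y \<notin> fvs \<Gamma> \<union> fvs \<Delta> \<Longrightarrow>
    Suc x \<notin> fv \<psi> \<Longrightarrow> Suc y \<notin> fv \<psi> \<Longrightarrow>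
    Suc (Suc x) \<notin> fv \<phi> \<Longrightarrow> Suc (Suc y) \<notin> fv \<phi> \<Longrightarrow>
    wf_seq \<Sigma> (insert (inst \<psi> s) (insert (RTC \<phi> s t) \<Gamma>) \<turnstile> insert (inst \<psi> t) \<Delta>) \<Longrightarrow>
    RTC_G \<Sigma> (insert (inst \<psi> s) (insert (RTC \<phi> s t) \<Gamma>) \<turnstile> insert (inst \<psi> t) \<Delta>)"

text \<open>
  Nodes of derivation trees carry the part of the rule instance that traces depend on: the
  substitution of (Subst), and for (Case) the principal formula and its immediate ancestor.
\<close>

datatype ('f, 'p) label =
  BaseI | SubstI "nat \<Rightarrow> 'f tm" | CaseI "('f, 'p) fm" "('f, 'p) fm"

inductive omega_rule ::
  "('f, 'p) label \<Rightarrow> ('f, 'p) sequent list \<Rightarrow> ('f, 'p) sequent \<Rightarrow> bool" where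
  Base: "base_rule Ps S \<Longrightarrow> omega_rule BaseI Ps S"
| Subst: "omega_rule (SubstI \<theta>) [\<Gamma> \<turnstile> \<Delta>] (subst \<theta> ` \<Gamma> \<turnstile> subst \<theta> ` \<Delta>)"
| Case: "z \<notin> fvs \<Gamma> \<union> fvs \<Delta> \<union> fv (RTC \<phi> s t) \<Longrightarrow>
    omega_rule (CaseI (RTC \<phi> s t) (RTC \<phi> s (Var z)))
      [insert (Eq s t) \<Gamma> \<turnstile> \<Delta>,
       insert (RTC \<phi> s (Var z)) (insert (inst2 \<phi> (Var z) t) \<Gamma>) \<turnstile> \<Delta>]
      (insert (RTC \<phi> s t) \<Gamma> \<turnstile> \<Delta>)"

codatatype ('f, 'p) tree =
  Node (concl: "('f, 'p) sequent") (label: "('f, 'p) label") (children: "('f, 'p) tree list")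

inductive has_subtree :: "('f, 'p) tree \<Rightarrow> ('f, 'p) tree \<Rightarrow> bool" for T :: "('f, 'p) tree" where
  here: "has_subtree T T"
| child: "has_subtree T U \<Longrightarrow> V \<in> set (children U) \<Longrightarrow> has_subtree T V"

definition pre_proof :: "('f, 'p) signature \<Rightarrow> ('f, 'p) tree \<Rightarrow> bool" where
  "pre_proof \<Sigma> T \<longleftrightarrow>
     (\<forall>U. has_subtree T U \<longrightarrow> wf_seq \<Sigma> (concl U) \<and>
        omega_rule (label U) (map concl (children U)) (concl U))"

text \<open>
  An infinite path is given by its nodes \<open>p\<close> together with the positions \<open>c\<close> of the premises it
  passes through.
\<close>

definition infinite_path ::
  "('f, 'p) tree \<Rightarrow> (nat \<Rightarrow> ('f, 'p) tree) \<Rightarrow> (nat \<Rightarrow> nat) \<Rightarrow> bool" where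
  "infinite_path T p c \<longleftrightarrow>
     p 0 = T \<and> (\<forall>i. c i < length (children (p i)) \<and> p (Suc i) = children (p i) ! c i)"

definition progressing :: "('f, 'p) tree \<Rightarrow> nat \<Rightarrow> ('f, 'p) fm \<Rightarrow> ('f, 'p) fm \<Rightarrow> bool" where
  "progressing U j \<tau> \<tau>' \<longleftrightarrow> label U = CaseI \<tau> \<tau>' \<and> j = 1"

definition trace_pair :: "('f, 'p) tree \<Rightarrow> nat \<Rightarrow> ('f, 'p) fm \<Rightarrow> ('f, 'p) fm \<Rightarrow> bool" where
  "trace_pair U j \<tau> \<tau>' \<longleftrightarrow>
     is_RTC \<tau> \<and> is_RTC \<tau>' \<and>
     \<tau> \<in> ant (concl U) \<and> \<tau>' \<in> ant (concl (children U ! j)) \<and>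
     (case label U of
        SubstI \<theta> \<Rightarrow> \<tau> = subst \<theta> \<tau>'
      | CaseI _ _ \<Rightarrow> progressing U j \<tau> \<tau>' \<or> \<tau> = \<tau>'
      | BaseI \<Rightarrow> \<tau> = \<tau>')"

definition global_trace_condition :: "('f, 'p) tree \<Rightarrow> bool" where
  "global_trace_condition T \<longleftrightarrow>
     (\<forall>p c. infinite_path T p c \<longrightarrow>
        (\<exists>k \<tau>. (\<forall>i\<ge>k. trace_pair (p i) (c i) (\<tau> i) (\<tau> (Suc i))) \<and>
               infinite {i. k \<le> i \<and> progressing (p i) (c i) (\<tau> i) (\<tau> (Suc i))}))"

definition omega_proof :: "('f, 'p) signature \<Rightarrow> ('f, 'p) tree \<Rightarrow> bool" where
  "omega_proof \<Sigma> T \<longleftrightarrow> pre_proof \<Sigma> T \<and> global_trace_condition T"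

text \<open>Finite trees are regular, as all trees here are finitely branching.\<close>

definition regular_tree :: "('f, 'p) tree \<Rightarrow> bool" where
  "regular_tree T \<longleftrightarrow> finite {U. has_subtree T U}"

definition CRTC_omega_G :: "('f, 'p) signature \<Rightarrow> ('f, 'p) sequent \<Rightarrow> bool" where
  "CRTC_omega_G \<Sigma> S \<longleftrightarrow> (\<exists>T. concl T = S \<and> omega_proof \<Sigma> T \<and> regular_tree T)"

end

theory Submission
  imports Defs "HOL-Library.Countable_Set"
begin

text \<open>
  An application of (Ind) becomes a cycle. With a fresh variable \<open>z\<close> for \<open>t\<close>, apply (Case) to
  \<open>RTC \<phi> s z\<close>: the case \<open>s = z\<close> is an equality inference, and in the other case, with \<open>RTC \<phi> s w\<close> and
  \<open>\<phi>(w, z)\<close>, a cut on \<open>\<psi>(w)\<close> leaves an instance of the induction step and the sequent one started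
  from with \<open>w\<close> for \<open>z\<close>. All other rules of the finitary system are rules of the cyclic one.

  Completeness is therefore a matter of the finitary system, where it follows by Henkin's construction.
  An underivable sequent mentions finitely many symbols, so it extends to a maximal consistent set of
  countably many formulas, with variables as witnesses, and the elements of the model are classes of
  variables. The admissible sets are those definable by these formulas: (Ind) makes a provable
  \<open>RTC \<phi> s t\<close> true, while (Refl) and (Trans) make the set defined by \<open>RTC \<phi> s x\<close> a
  counterexample to an unprovable one. The remaining symbols of the signature are interpreted by a fixed
  element and the empty predicate, which does not create new definable sets.
\<close>


section \<open>Substitution\<close>

lemma up_simps [simp]:
  "up \<theta> 0 = Var 0"
  "up \<theta> (Suc n) = subst_tm (\<lambda>k. Var (Suc k)) (\<theta> n)"
  by (simp_all add: up_def)

lemma subst_tm_subst_tm: "subst_tm \<theta> (subst_tm \<sigma> t) = subst_tm (\<lambda>n. subst_tm \<theta> (\<sigma> n)) t"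
  by (induct t) auto

lemma subst_tm_up: "(\<lambda>n. subst_tm (up \<theta>) (up \<sigma> n)) = up (\<lambda>n. subst_tm \<theta> (\<sigma> n))"
proof
  fix n
  show "subst_tm (up \<theta>) (up \<sigma> n) = up (\<lambda>n. subst_tm \<theta> (\<sigma> n)) n"
    by (cases n) (simp_all add: subst_tm_subst_tm)
qed

lemma subst_subst: "subst \<theta> (subst \<sigma> \<phi>) = subst (\<lambda>n. subst_tm \<theta> (\<sigma> n)) \<phi>"
  by (induct \<phi> arbitrary: \<theta> \<sigma>) (simp_all add: subst_tm_subst_tm subst_tm_up o_def)

lemma subst_tm_cong: "(\<And>n. n \<in> fv_tm t \<Longrightarrow> \<theta> n = \<sigma> n) \<Longrightarrow> subst_tm \<theta> t = subst_tm \<sigma> t"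
  by (induct t) auto

text \<open>\<open>A\<close> is left arbitrary so that the lemma can be iterated under the two
  binders of \<open>RTC\<close>.\<close>

lemma up_cong:
  "(\<And>n. Suc n \<in> A \<Longrightarrow> \<theta> n = \<sigma> n) \<Longrightarrow> n \<in> A \<Longrightarrow> up \<theta> n = up \<sigma> n"
  by (cases n) auto

lemma subst_cong: "(\<And>n. n \<in> fv \<phi> \<Longrightarrow> \<theta> n = \<sigma> n) \<Longrightarrow> subst \<theta> \<phi> = subst \<sigma> \<phi>"
proof (induct \<phi> arbitrary: \<theta> \<sigma>)
  case (Eq s t)
  then show ?case by (auto intro!: subst_tm_cong)
next
  case (Pred p ts)
  then show ?case by (auto intro!: subst_tm_cong)
next
  case (Uni \<phi>)
  show ?case
    using Uni(1)[of "up \<theta>" "up \<sigma>"] up_cong[of "fv \<phi>" \<theta> \<sigma>] Uni(2) by simp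
next
  case (Exi \<phi>)
  show ?case
    using Exi(1)[of "up \<theta>" "up \<sigma>"] up_cong[of "fv \<phi>" \<theta> \<sigma>] Exi(2) by simp
next
  case (RTC \<phi> s t)
  have "up (up \<theta>) n = up (up \<sigma>) n" if "n \<in> fv \<phi>" for n
    by (rule up_cong[OF up_cong[of "{n. Suc n \<in> fv \<phi>}"] that]) (use RTC(2) in auto)
  moreover have "subst_tm \<theta> s = subst_tm \<sigma> s" "subst_tm \<theta> t = subst_tm \<sigma> t"
    using RTC(2) by (auto intro!: subst_tm_cong)
  ultimately show ?case using RTC(1)[of "up (up \<theta>)" "up (up \<sigma>)"] by simp
next
  case (Neg \<phi>)
  show ?case using Neg(1)[of \<theta> \<sigma>] Neg(2) by simp
next
  case (Con \<phi> \<psi>)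
  show ?case using Con(1,2)[of \<theta> \<sigma>] Con(3) by simp
next
  case (Dis \<phi> \<psi>)
  show ?case using Dis(1,2)[of \<theta> \<sigma>] Dis(3) by simp
next
  case (Imp \<phi> \<psi>)
  show ?case using Imp(1,2)[of \<theta> \<sigma>] Imp(3) by simp
qed

lemma subst_tm_Var: "subst_tm Var t = t"
  by (induct t) (auto intro: map_idI)

lemma up_Var: "up Var = Var"
proof
  show "up Var n = Var n" for n by (cases n) auto
qed

lemma subst_Var: "subst Var \<phi> = \<phi>"
  by (induct \<phi>) (auto simp: subst_tm_Var up_Var intro: map_idI)

lemma subst_tm_fresh: "(\<And>n. n \<in> fv_tm t \<Longrightarrow> \<theta> n = Var n) \<Longrightarrow> subst_tm \<theta> t = t"
  using subst_tm_cong[of t \<theta> Var] by (simp add: subst_tm_Var)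

lemma subst_fresh: "(\<And>n. n \<in> fv \<phi> \<Longrightarrow> \<theta> n = Var n) \<Longrightarrow> subst \<theta> \<phi> = \<phi>"
  using subst_cong[of \<phi> \<theta> Var] by (simp add: subst_Var)

text \<open>Moving only variables foreign to the body changes just the endpoints of an RTC formula;
  the trace formulas on a cycle are matched in this way.\<close>

lemma subst_up_up_fresh:
  assumes "\<And>n. Suc (Suc n) \<in> fv \<phi> \<Longrightarrow> \<theta> n = Var n"
  shows "subst (up (up \<theta>)) \<phi> = \<phi>"
proof (rule subst_fresh)
  fix n assume "n \<in> fv \<phi>"
  then have "up (up \<theta>) n = up (up Var) n"
    by (rule up_cong[OF up_cong[of "{n. Suc n \<in> fv \<phi>}"], rotated 2]) (use assms in auto)
  then show "up (up \<theta>) n = Var n" by (simp add: up_Var)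
qed

lemma subst_image_fresh: "(\<And>n. n \<in> fvs \<Gamma> \<Longrightarrow> \<theta> n = Var n) \<Longrightarrow> subst \<theta> ` \<Gamma> = \<Gamma>"
  using subst_fresh[of _ \<theta>] unfolding fvs_def by (force simp: image_iff)

lemma subst_inst: "subst \<theta> (inst \<phi> t) = subst (case_nat (subst_tm \<theta> t) \<theta>) \<phi>"
  unfolding inst_def subst_subst by (rule subst_cong) (simp split: nat.split)

lemma subst_inst2:
  "subst \<theta> (inst2 \<phi> s t) = subst (case_nat (subst_tm \<theta> s) (case_nat (subst_tm \<theta> t) \<theta>)) \<phi>"
  unfolding inst2_def subst_subst by (rule subst_cong) (simp split: nat.split)

text \<open>Instantiation undoes the shift inside \<open>up\<close>. In the truth lemma this links
  the instances of a quantified formula to extended valuations.\<close>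

lemma inst_subst_up: "inst (subst (up \<theta>) \<phi>) t = subst (case_nat t \<theta>) \<phi>"
  unfolding inst_def subst_subst
  by (rule subst_cong) (simp add: subst_tm_subst_tm subst_tm_Var split: nat.split)

lemma inst2_subst_up: "inst2 (subst (up (up \<theta>)) \<phi>) s t = subst (case_nat s (case_nat t \<theta>)) \<phi>"
  unfolding inst2_def subst_subst
  by (rule subst_cong) (simp add: subst_tm_subst_tm subst_tm_Var split: nat.split)

section \<open>Well-formedness and finiteness of free variables\<close>

lemma wf_tm_subst: "wf_tm \<Sigma> t \<Longrightarrow> (\<And>n. wf_tm \<Sigma> (\<theta> n)) \<Longrightarrow> wf_tm \<Sigma> (subst_tm \<theta> t)"
  by (induct t) auto

lemma wf_tm_up: "(\<And>n. wf_tm \<Sigma> (\<theta> n)) \<Longrightarrow> wf_tm \<Sigma> (up \<theta> n)"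
  by (cases n) (auto intro: wf_tm_subst)

lemma wf_fm_subst: "wf_fm \<Sigma> \<phi> \<Longrightarrow> (\<And>n. wf_tm \<Sigma> (\<theta> n)) \<Longrightarrow> wf_fm \<Sigma> (subst \<theta> \<phi>)"
  by (induct \<phi> arbitrary: \<theta>) (auto intro: wf_tm_subst wf_tm_up)

lemma wf_fm_inst: "wf_fm \<Sigma> \<phi> \<Longrightarrow> wf_tm \<Sigma> t \<Longrightarrow> wf_fm \<Sigma> (inst \<phi> t)"
  unfolding inst_def by (rule wf_fm_subst) (auto split: nat.split)

lemma wf_fm_inst2: "wf_fm \<Sigma> \<phi> \<Longrightarrow> wf_tm \<Sigma> s \<Longrightarrow> wf_tm \<Sigma> t \<Longrightarrow> wf_fm \<Sigma> (inst2 \<phi> s t)"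
  unfolding inst2_def by (rule wf_fm_subst) (auto split: nat.split)

lemma wf_tm_subst_rev: "wf_tm \<Sigma> (subst_tm \<theta> t) \<Longrightarrow> wf_tm \<Sigma> t"
  by (induct t) auto

text \<open>Substitution replaces variables only, so every symbol survives it. Hence a schema such
  as \<open>\<psi>\<close> in (Ind) is well-formed as soon as one of its instances is.\<close>

lemma wf_fm_subst_rev: "wf_fm \<Sigma> (subst \<theta> \<phi>) \<Longrightarrow> wf_fm \<Sigma> \<phi>"
  by (induct \<phi> arbitrary: \<theta>) (auto dest: wf_tm_subst_rev)

lemma wf_fm_inst_rev: "wf_fm \<Sigma> (inst \<phi> t) \<Longrightarrow> wf_fm \<Sigma> \<phi>"
  unfolding inst_def by (rule wf_fm_subst_rev)

lemma finite_fv_tm: "finite (fv_tm t)"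
  by (induct t) auto

lemma finite_pred_image: "finite A \<Longrightarrow> finite {n. Suc n \<in> A}"
  using finite_vimageI[of A Suc] by (simp add: vimage_def)

lemma finite_pred_image2: "finite A \<Longrightarrow> finite {n. Suc (Suc n) \<in> A}"
  using finite_pred_image[OF finite_pred_image[of A]] by simp

lemma finite_fv: "finite (fv \<phi>)"
proof (induct \<phi>)
  case (RTC \<phi> s t)
  then show ?case by (simp add: finite_fv_tm finite_pred_image2)
qed (auto simp: finite_fv_tm finite_pred_image)

lemma finite_fvs: "finite \<Gamma> \<Longrightarrow> finite (fvs \<Gamma>)"
  unfolding fvs_def by (auto simp: finite_fv)

lemma fresh_nat: "finite (A :: nat set) \<Longrightarrow> \<exists>n. n \<notin> A"
  by (rule ex_new_if_finite) simp_all

lemma fvs_insert [simp]: "fvs (insert \<phi> \<Gamma>) = fv \<phi> \<union> fvs \<Gamma>"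
  by (auto simp: fvs_def)

lemma fvs_empty [simp]: "fvs {} = {}"
  by (simp add: fvs_def)

lemma wf_seq_simp [simp]:
  "wf_seq \<Sigma> (\<Gamma> \<turnstile> \<Delta>) \<longleftrightarrow>
     finite \<Gamma> \<and> finite \<Delta> \<and> (\<forall>\<phi>\<in>\<Gamma>. wf_fm \<Sigma> \<phi>) \<and> (\<forall>\<phi>\<in>\<Delta>. wf_fm \<Sigma> \<phi>)"
  by (auto simp: wf_seq_def)


section \<open>Cyclic proofs\<close>

text \<open>The global trace condition for a single path, isolated so that it can be transferred
  from a suffix.\<close>

definition traceable :: "(nat \<Rightarrow> ('f, 'p) tree) \<Rightarrow> (nat \<Rightarrow> nat) \<Rightarrow> bool" where
  "traceable p c \<longleftrightarrow>
     (\<exists>k \<tau>. (\<forall>i\<ge>k. trace_pair (p i) (c i) (\<tau> i) (\<tau> (Suc i))) \<and>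
        infinite {i. k \<le> i \<and> progressing (p i) (c i) (\<tau> i) (\<tau> (Suc i))})"

definition regular_proof :: "('f, 'p) signature \<Rightarrow> ('f, 'p) tree \<Rightarrow> bool" where
  "regular_proof \<Sigma> T \<longleftrightarrow> omega_proof \<Sigma> T \<and> regular_tree T"

lemma infinite_shift:
  fixes P :: "nat \<Rightarrow> bool"
  assumes "infinite {i. P i}"
  shows "infinite {i. n \<le> i \<and> P (i - n)}"
proof -
  have "(\<lambda>i. i + n) ` {i. P i} \<subseteq> {i. n \<le> i \<and> P (i - n)}" by auto
  moreover have "infinite ((\<lambda>i. i + n) ` {i. P i})"
    using assms by (simp add: finite_image_iff)
  ultimately show ?thesis using infinite_super by blast
qed

text \<open>A trace may start at any offset, so a trace along a suffix serves the whole path after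
  reindexing.\<close>

lemma traceable_shift:
  assumes "traceable (\<lambda>i. p (i + n)) (\<lambda>i. c (i + n))"
  shows "traceable p c"
proof -
  obtain k \<tau> where tp: "\<And>i. i \<ge> k \<Longrightarrow> trace_pair (p (i + n)) (c (i + n)) (\<tau> i) (\<tau> (Suc i))"
    and inf: "infinite {i. k \<le> i \<and> progressing (p (i + n)) (c (i + n)) (\<tau> i) (\<tau> (Suc i))}"
    using assms unfolding traceable_def by blast
  \<comment> \<open>For \<open>i < n\<close> the truncated subtraction yields
    \<open>\<tau> 0\<close>; these positions lie before the offset \<open>k + n\<close> and do not
    count.\<close>
  define \<upsilon> where "\<upsilon> i = \<tau> (i - n)" for i
  have "trace_pair (p i) (c i) (\<upsilon> i) (\<upsilon> (Suc i))" if "i \<ge> k + n" for i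
    using tp[of "i - n"] that by (simp add: \<upsilon>_def Suc_diff_le)
  moreover have "infinite {i. k + n \<le> i \<and> progressing (p i) (c i) (\<upsilon> i) (\<upsilon> (Suc i))}"
    using infinite_shift[OF inf, of n]
    by (rule infinite_super[rotated]) (auto simp: \<upsilon>_def Suc_diff_le)
  ultimately show ?thesis unfolding traceable_def by blast
qed

lemma infinite_path_suffix:
  "infinite_path T p c \<Longrightarrow> infinite_path (p n) (\<lambda>i. p (i + n)) (\<lambda>i. c (i + n))"
  by (simp add: infinite_path_def)

text \<open>
  Every path from \<open>T\<close> either stays in the finite set \<open>K\<close> of nodes for ever or enters a proof that is
  already known to be good, whose traces serve from then on.
\<close>

lemma regular_proof_closure:
  assumes K: "finite K" "T \<in> K"
    and node: "\<And>U. U \<in> K \<Longrightarrow> wf_seq \<Sigma> (concl U) \<and>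
      omega_rule (label U) (map concl (children U)) (concl U)"
    and children: "\<And>U V. U \<in> K \<Longrightarrow> V \<in> set (children U) \<Longrightarrow> V \<in> K \<or> regular_proof \<Sigma> V"
    and cyc: "\<And>p c. infinite_path T p c \<Longrightarrow> (\<And>i. p i \<in> K \<and> \<not> regular_proof \<Sigma> (p i)) \<Longrightarrow>
      traceable p c"
  shows "regular_proof \<Sigma> T"
proof -
  \<comment> \<open>The finished proofs hanging directly off \<open>K\<close>. Every subtree of
    \<open>T\<close> lies in \<open>K\<close> or in one of these finitely many regular trees, which
    gives both local correctness and regularity.\<close>
  define G where "G = {V. regular_proof \<Sigma> V \<and> (\<exists>U\<in>K. V \<in> set (children U))}"
  have "G \<subseteq> (\<Union>U\<in>K. set (children U))" by (auto simp: G_def)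
  then have finG: "finite G" using K(1) by (auto intro: finite_subset)
  have sub: "U \<in> K \<or> (\<exists>V\<in>G. has_subtree V U)" if "has_subtree T U" for U
    using that
  proof (induct rule: has_subtree.induct)
    case here
    then show ?case using K(2) by simp
  next
    case (child U V)
    then show ?case
      using children[of U V] by (auto simp: G_def intro: has_subtree.intros)
  qed
  have "pre_proof \<Sigma> T"
    unfolding pre_proof_def
  proof (intro allI impI)
    fix U assume "has_subtree T U"
    then show "wf_seq \<Sigma> (concl U) \<and> omega_rule (label U) (map concl (children U)) (concl U)"
      using sub[of U] node[of U]
      by (auto simp: G_def regular_proof_def omega_proof_def pre_proof_def)
  qed
  moreover have "regular_tree T"
  proof -
    have "{U. has_subtree T U} \<subseteq> K \<union> (\<Union>V\<in>G. {U. has_subtree V U})" using sub by auto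
    moreover have "finite (K \<union> (\<Union>V\<in>G. {U. has_subtree V U}))"
      using K(1) finG by (auto simp: G_def regular_proof_def regular_tree_def)
    ultimately show ?thesis unfolding regular_tree_def by (rule finite_subset)
  qed
  moreover have "global_trace_condition T"
    unfolding global_trace_condition_def traceable_def[symmetric]
  proof (intro allI impI)
    fix p c assume path: "infinite_path T p c"
    have p0: "p 0 \<in> K" using path K(2) by (simp add: infinite_path_def)
    show "traceable p c"
    proof (cases "\<exists>n. regular_proof \<Sigma> (p n)")
      case True
      then obtain n where "regular_proof \<Sigma> (p n)" by blast
      then have "traceable (\<lambda>i. p (i + n)) (\<lambda>i. c (i + n))"
        using infinite_path_suffix[OF path, of n]
        unfolding regular_proof_def omega_proof_def global_trace_condition_def
          traceable_def[symmetric] by blast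
      then show ?thesis by (rule traceable_shift)
    next
      case False
      have "p i \<in> K" for i
      proof (induct i)
        case (Suc i)
        have "p (Suc i) \<in> set (children (p i))"
          using path by (simp add: infinite_path_def)
        then show ?case using children[OF Suc] False by blast
      qed (rule p0)
      then show ?thesis using cyc[OF path] False by blast
    qed
  qed
  ultimately show ?thesis by (simp add: regular_proof_def omega_proof_def)
qed

text \<open>With a single node as \<open>K\<close> the condition on lasting paths is vacuous: one
  step leads into a finished proof.\<close>

lemma regular_proof_Node:
  assumes "omega_rule l (map concl Ts) S" "wf_seq \<Sigma> S" "\<forall>T\<in>set Ts. regular_proof \<Sigma> T"
  shows "regular_proof \<Sigma> (Node S l Ts)"
proof (rule regular_proof_closure[where K = "{Node S l Ts}"])
  fix p c assume path: "infinite_path (Node S l Ts) p c"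
    and stay: "\<And>i. p i \<in> {Node S l Ts} \<and> \<not> regular_proof \<Sigma> (p i)"
  have "p (Suc 0) \<in> set Ts"
    using path stay[of 0] unfolding infinite_path_def by (metis nth_mem singletonD tree.sel(3))
  then show "traceable p c" using assms(3) stay[of "Suc 0"] by blast
qed (use assms in auto)

lemma CRTC_iff: "CRTC_omega_G \<Sigma> S \<longleftrightarrow> (\<exists>T. concl T = S \<and> regular_proof \<Sigma> T)"
  by (auto simp: CRTC_omega_G_def regular_proof_def)

lemma CRTC_rule:
  assumes "omega_rule l Ps S" "wf_seq \<Sigma> S" "\<forall>P\<in>set Ps. CRTC_omega_G \<Sigma> P"
  shows "CRTC_omega_G \<Sigma> S"
proof -
  have "\<forall>P\<in>set Ps. \<exists>T. concl T = P \<and> regular_proof \<Sigma> T"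
    using assms(3) by (simp add: CRTC_iff)
  then obtain F where F: "\<forall>P\<in>set Ps. concl (F P) = P \<and> regular_proof \<Sigma> (F P)"
    by metis
  then have "map concl (map F Ps) = Ps" by (auto intro: map_idI)
  then have "regular_proof \<Sigma> (Node S l (map F Ps))"
    using assms F by (intro regular_proof_Node) auto
  then show ?thesis unfolding CRTC_iff by (metis tree.sel(1))
qed

lemma CRTC_base:
  "base_rule Ps S \<Longrightarrow> wf_seq \<Sigma> S \<Longrightarrow> \<forall>P\<in>set Ps. CRTC_omega_G \<Sigma> P \<Longrightarrow> CRTC_omega_G \<Sigma> S"
  by (rule CRTC_rule[OF omega_rule.Base])

lemma CRTC_wf: "CRTC_omega_G \<Sigma> S \<Longrightarrow> wf_seq \<Sigma> S"
  unfolding CRTC_omega_G_def omega_proof_def pre_proof_def by (auto intro: has_subtree.here)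

lemma CRTC_ax: "\<phi> \<in> \<Gamma> \<Longrightarrow> \<phi> \<in> \<Delta> \<Longrightarrow> wf_seq \<Sigma> (\<Gamma> \<turnstile> \<Delta>) \<Longrightarrow> CRTC_omega_G \<Sigma> (\<Gamma> \<turnstile> \<Delta>)"
  using CRTC_base[OF base_rule.Weak[of "{\<phi>}" \<Gamma> "{\<phi>}" \<Delta>], of \<Sigma>] CRTC_base[OF base_rule.Ax, of \<Sigma> \<phi>]
  by auto

text \<open>
  The trace along the cycle \<open>A\<close>, \<open>C\<close>, \<open>B\<close> alternates between \<open>RTC \<phi> s z\<close> and \<open>RTC \<phi> s w\<close>. It
  progresses at \<open>A\<close>, once in every round.
\<close>

lemma regular_proof_cycle:
  fixes \<phi> \<psi> :: "('f, 'p) fm" and s :: "'f tm" and z w :: nat and \<Gamma> \<Delta> :: "('f, 'p) fm set"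
  defines "A \<equiv> insert (RTC \<phi> s (Var z)) (insert (inst \<psi> s) \<Gamma>) \<turnstile> insert (inst \<psi> (Var z)) \<Delta>"
  defines "C \<equiv> insert (RTC \<phi> s (Var w)) (insert (inst2 \<phi> (Var w) (Var z)) (insert (inst \<psi> s) \<Gamma>))
      \<turnstile> insert (inst \<psi> (Var z)) \<Delta>"
  defines "B \<equiv> insert (RTC \<phi> s (Var w)) (insert (inst \<psi> s) \<Gamma>) \<turnstile> insert (inst \<psi> (Var w)) \<Delta>"
  assumes wfA: "wf_seq \<Sigma> A"
    and z: "z \<notin> fvs \<Gamma> \<union> fvs \<Delta> \<union> fv (inst \<psi> s)" "z \<notin> fv_tm s"
      "Suc z \<notin> fv \<psi>" "Suc (Suc z) \<notin> fv \<phi>"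
    and w: "w \<notin> fvs (insert (inst \<psi> s) \<Gamma>) \<union> fvs (insert (inst \<psi> (Var z)) \<Delta>) \<union> fv (RTC \<phi> s (Var z))"
    and L: "regular_proof \<Sigma> L"
      "concl L = (insert (Eq s (Var z)) (insert (inst \<psi> s) \<Gamma>) \<turnstile> insert (inst \<psi> (Var z)) \<Delta>)"
    and R: "regular_proof \<Sigma> R"
      "concl R = (insert (inst \<psi> (Var w)) (insert (inst2 \<phi> (Var w) (Var z)) \<Gamma>)
        \<turnstile> insert (inst \<psi> (Var z)) \<Delta>)"
  shows "CRTC_omega_G \<Sigma> A"
proof -
  \<comment> \<open>Renaming \<open>z\<close> to \<open>w\<close> turns \<open>A\<close> into
    \<open>B\<close>; this (Subst), with conclusion \<open>B\<close> and premise \<open>A\<close>,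
    is the back edge of the cycle.\<close>
  define \<theta> :: "nat \<Rightarrow> 'f tm" where "\<theta> = Var(z := Var w)"
  let ?\<tau> = "RTC \<phi> s (Var z)" and ?\<tau>' = "RTC \<phi> s (Var w)"
  \<comment> \<open>Corecursion over three states: 0, 1, 2 stand for \<open>A\<close>,
    \<open>C\<close>, \<open>B\<close>. \<open>Inr\<close> continues with a state and
    \<open>Inl\<close> grafts a finished proof, so the tree reached again at \<open>A\<close> is
    literally the same one.\<close>
  define unf where "unf = corec_tree
    (\<lambda>n::nat. if n = 0 then A else if n = 1 then C else B)
    (\<lambda>n. if n = 0 then CaseI ?\<tau> ?\<tau>' else if n = 1 then BaseI else (SubstI \<theta> :: ('f, 'p) label))
    (\<lambda>n. if n = 0 then [Inl L, Inr 1] else if n = 1 then [Inr 2, Inl R] else [Inr 0])"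
  let ?A = "unf 0" and ?C = "unf 1" and ?B = "unf 2"
  have A_eq: "?A = Node A (CaseI ?\<tau> ?\<tau>') [L, ?C]"
    unfolding unf_def by (subst tree.corec) simp
  have C_eq: "?C = Node C BaseI [?B, R]"
    unfolding unf_def by (subst tree.corec) simp
  have B_eq: "?B = Node B (SubstI \<theta>) [?A]"
    unfolding unf_def by (subst tree.corec) simp
  have sub_\<Gamma>: "subst \<theta> ` \<Gamma> = \<Gamma>" "subst \<theta> ` \<Delta> = \<Delta>"
    using z by (auto intro!: subst_image_fresh simp: \<theta>_def)
  have sub_\<psi>s: "subst \<theta> (inst \<psi> s) = inst \<psi> s"
    using z by (intro subst_fresh) (auto simp: \<theta>_def)
  have sub_s: "subst_tm \<theta> s = s"
    using z by (intro subst_tm_fresh) (auto simp: \<theta>_def)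
  \<comment> \<open>As \<open>z\<close> is foreign to \<open>\<psi>\<close> itself, it occurs in
    \<open>inst \<psi> (Var z)\<close> only in the place of the induction variable.\<close>
  have sub_\<psi>z: "subst \<theta> (inst \<psi> (Var z)) = inst \<psi> (Var w)"
    unfolding subst_inst unfolding inst_def
    by (rule subst_cong) (use z in \<open>auto simp: \<theta>_def split: nat.split\<close>)
  have sub_\<phi>: "subst (up (up \<theta>)) \<phi> = \<phi>"
    using z by (intro subst_up_up_fresh) (auto simp: \<theta>_def)
  have sub_\<tau>: "subst \<theta> ?\<tau> = ?\<tau>'"
    using sub_s sub_\<phi> by (simp add: \<theta>_def)
  have wfC: "wf_seq \<Sigma> C" "wf_seq \<Sigma> B"
    using wfA wf_fm_inst2[of \<Sigma> \<phi> "Var w" "Var z"] wf_fm_inst_rev[of \<Sigma> \<psi> "s"]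
      wf_fm_inst[of \<Sigma> \<psi>]
    by (auto simp: A_def B_def C_def)
  have rA: "omega_rule (CaseI ?\<tau> ?\<tau>') [concl L, C] A"
    unfolding L A_def C_def using w by (intro omega_rule.Case) auto
  \<comment> \<open>The cut formula is \<open>inst \<psi> (Var w)\<close>: \<open>B\<close> yields
    it and \<open>R\<close> consumes it, and the two contexts unite to that of
    \<open>C\<close>.\<close>
  have rC: "omega_rule BaseI [B, concl R] C"
  proof -
    have "C = (insert ?\<tau>' (insert (inst \<psi> s) \<Gamma>) \<union> insert (inst2 \<phi> (Var w) (Var z)) \<Gamma>
      \<turnstile> \<Delta> \<union> insert (inst \<psi> (Var z)) \<Delta>)"
      unfolding C_def by auto
    then show ?thesis unfolding B_def R by (metis base_rule.Cut omega_rule.Base)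
  qed
  have rB: "omega_rule (SubstI \<theta>) [A] B"
  proof -
    have "B = (subst \<theta> ` (insert ?\<tau> (insert (inst \<psi> s) \<Gamma>)) \<turnstile> subst \<theta> ` (insert (inst \<psi> (Var z)) \<Delta>))"
      unfolding B_def image_insert sub_\<Gamma> sub_\<psi>s sub_\<psi>z sub_\<tau> ..
    then show ?thesis unfolding A_def by (metis omega_rule.Subst)
  qed
  have "regular_proof \<Sigma> ?A"
  proof (rule regular_proof_closure[where K = "{?A, ?B, ?C}"])
    fix U assume "U \<in> {?A, ?B, ?C}"
    then show "wf_seq \<Sigma> (concl U) \<and> omega_rule (label U) (map concl (children U)) (concl U)"
      using A_eq B_eq C_eq wfA wfC rA rB rC
      by (smt (verit) insertE list.simps(8,9) singletonD tree.sel)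
  next
    fix U V assume "U \<in> {?A, ?B, ?C}" "V \<in> set (children U)"
    then show "V \<in> {?A, ?B, ?C} \<or> regular_proof \<Sigma> V"
      using A_eq B_eq C_eq L R by (smt (verit) insert_iff list.set singletonD tree.sel)
  next
    fix p c assume path: "infinite_path ?A p c"
      and stay: "\<And>i. p i \<in> {?A, ?B, ?C} \<and> \<not> regular_proof \<Sigma> (p i)"
    have pS: "c i < length (children (p i))" "p (Suc i) = children (p i) ! c i" for i
      using path by (simp_all add: infinite_path_def)
    \<comment> \<open>The other premise is the finished proof \<open>L\<close>, which the path is
      assumed to avoid.\<close>
    have stepA: "c i = 1 \<and> p (Suc i) = ?C" if "p i = ?A" for i
    proof -
      have ch: "children (p i) = [L, ?C]" using that A_eq by (metis tree.sel(3))
      then have "c i = 0 \<or> c i = 1" using pS(1)[of i] by auto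
      moreover have "c i \<noteq> 0"
        using pS(2)[of i] ch stay[of "Suc i"] L(1) by (metis nth_Cons_0)
      ultimately show ?thesis using pS(2)[of i] ch by simp
    qed
    have stepC: "c i = 0 \<and> p (Suc i) = ?B" if "p i = ?C" for i
    proof -
      have ch: "children (p i) = [?B, R]" using that C_eq by (metis tree.sel(3))
      then have "c i = 0 \<or> c i = 1" using pS(1)[of i] by auto
      moreover have "c i \<noteq> 1"
        using pS(2)[of i] ch stay[of "Suc i"] R(1)
        by (metis One_nat_def nth_Cons_0 nth_Cons_Suc)
      ultimately show ?thesis using pS(2)[of i] ch by simp
    qed
    have stepB: "c i = 0 \<and> p (Suc i) = ?A" if "p i = ?B" for i
    proof -
      have ch: "children (p i) = [?A]" using that B_eq by (metis tree.sel(3))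
      then show ?thesis using pS[of i] by auto
    qed
    have cycle: "p (3 * i) = ?A" for i
    proof (induct i)
      case 0
      then show ?case using path by (simp add: infinite_path_def)
    next
      case (Suc i)
      then show ?case using stepA[of "3 * i"] stepC[of "Suc (3 * i)"] stepB[of "Suc (Suc (3 * i))"]
        by (simp add: numeral_3_eq_3)
    qed
    \<comment> \<open>Positions 0, 1, 2 modulo 3 are \<open>A\<close>, \<open>C\<close>,
      \<open>B\<close>; only at \<open>A\<close> is the traced formula the one with
      \<open>z\<close>. From \<open>B\<close> back to \<open>A\<close> the pair is the one of
      (Subst), by \<open>sub_\<tau>\<close>.\<close>
    define \<upsilon> where "\<upsilon> i = (if i mod 3 = 0 then ?\<tau> else ?\<tau>')" for i :: nat
    have mem: "?\<tau> \<in> ant A" "?\<tau>' \<in> ant C" "?\<tau>' \<in> ant B"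
      by (simp_all add: A_def B_def C_def)
    have trace: "trace_pair (p i) (c i) (\<upsilon> i) (\<upsilon> (Suc i)) \<and>
        (i mod 3 = 0 \<longrightarrow> progressing (p i) (c i) (\<upsilon> i) (\<upsilon> (Suc i)))" for i
    proof -
      define q where "q = i div 3"
      consider "i = 3 * q" | "i = Suc (3 * q)" | "i = Suc (Suc (3 * q))"
        unfolding q_def by linarith
      then show ?thesis
      proof cases
        case 1
        then have "i mod 3 = 0" "Suc i mod 3 \<noteq> 0" by presburger+
        then have \<upsilon>: "\<upsilon> i = ?\<tau>" "\<upsilon> (Suc i) = ?\<tau>'" by (auto simp: \<upsilon>_def)
        have p: "p i = ?A" "c i = 1" using cycle[of q] stepA[of i] 1 by auto
        have prog: "progressing (p i) (c i) (\<upsilon> i) (\<upsilon> (Suc i))"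
          unfolding progressing_def p \<upsilon> by (subst A_eq) simp
        moreover have "concl ?A = A" "children ?A ! 1 = ?C" "concl ?C = C" "label ?A = CaseI ?\<tau> ?\<tau>'"
          using A_eq C_eq by (metis nth_Cons_0 nth_Cons_Suc One_nat_def tree.sel)+
        ultimately show ?thesis unfolding trace_pair_def p \<upsilon> using mem by simp
      next
        case 2
        then have "i mod 3 \<noteq> 0" "Suc i mod 3 \<noteq> 0" by presburger+
        then have \<upsilon>: "\<upsilon> i = ?\<tau>'" "\<upsilon> (Suc i) = ?\<tau>'" by (auto simp: \<upsilon>_def)
        have p: "p i = ?C" "c i = 0" using cycle[of q] stepA[of "3*q"] stepC[of i] 2 by auto
        moreover have "concl ?C = C" "children ?C ! 0 = ?B" "concl ?B = B" "label ?C = BaseI"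
          using B_eq C_eq by (metis nth_Cons_0 tree.sel)+
        ultimately show ?thesis unfolding trace_pair_def p \<upsilon> using mem \<open>i mod 3 \<noteq> 0\<close> by simp
      next
        case 3
        then have "i mod 3 \<noteq> 0" "Suc i mod 3 = 0" by presburger+
        then have \<upsilon>: "\<upsilon> i = ?\<tau>'" "\<upsilon> (Suc i) = ?\<tau>" by (auto simp: \<upsilon>_def)
        have p: "p i = ?B" "c i = 0"
          using cycle[of q] stepA[of "3*q"] stepC[of "Suc (3 * q)"] stepB[of i] 3 by auto
        moreover have "concl ?B = B" "children ?B ! 0 = ?A" "concl ?A = A" "label ?B = SubstI \<theta>"
          using B_eq A_eq by (metis nth_Cons_0 tree.sel)+
        ultimately show ?thesis
          unfolding trace_pair_def p \<upsilon> using mem \<open>i mod 3 \<noteq> 0\<close> sub_\<tau> by simp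
      qed
    qed
    have "range ((*) (3::nat)) \<subseteq> {i. 0 \<le> i \<and> progressing (p i) (c i) (\<upsilon> i) (\<upsilon> (Suc i))}"
      using trace by auto
    moreover have "infinite (range ((*) (3::nat)))"
      by (rule range_inj_infinite) (simp add: inj_on_def)
    ultimately show "traceable p c"
      unfolding traceable_def using trace infinite_super by blast
  qed auto
  moreover have "concl ?A = A" using A_eq by (metis tree.sel(1))
  ultimately show ?thesis unfolding CRTC_iff by blast
qed

text \<open>The back edge of the cycle renames the endpoint, which must therefore be a variable. The
  cycle is built for a fresh \<open>z\<close>, and one (Subst) at the root puts \<open>t\<close> in
  its place.\<close>

lemma CRTC_Ind:
  fixes \<phi> \<psi> :: "('f, 'p) fm"
  assumes prem: "CRTC_omega_G \<Sigma> (insert (inst \<psi> (Var x)) (insert (inst2 \<phi> (Var x) (Var y)) \<Gamma>)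
              \<turnstile> insert (inst \<psi> (Var y)) \<Delta>)"
    and xy: "x \<noteq> y" "x \<notin> fvs \<Gamma> \<union> fvs \<Delta>" "y \<notin> fvs \<Gamma> \<union> fvs \<Delta>" "Suc x \<notin> fv \<psi>" "Suc y \<notin> fv \<psi>"
      "Suc (Suc x) \<notin> fv \<phi>" "Suc (Suc y) \<notin> fv \<phi>"
    and wf: "wf_seq \<Sigma> (insert (inst \<psi> s) (insert (RTC \<phi> s t) \<Gamma>) \<turnstile> insert (inst \<psi> t) \<Delta>)"
  shows "CRTC_omega_G \<Sigma> (insert (inst \<psi> s) (insert (RTC \<phi> s t) \<Gamma>) \<turnstile> insert (inst \<psi> t) \<Delta>)"
proof -
  have fin: "finite \<Gamma>" "finite \<Delta>" and wf\<psi>: "wf_fm \<Sigma> \<psi>"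
    using wf wf_fm_inst_rev by auto
  have "finite (fvs \<Gamma> \<union> fvs \<Delta> \<union> fv (inst \<psi> s) \<union> fv_tm s \<union> {n. Suc n \<in> fv \<psi>} \<union> {n. Suc (Suc n) \<in> fv \<phi>})"
    by (simp add: fin finite_fvs finite_fv finite_fv_tm finite_pred_image finite_pred_image2)
  from fresh_nat[OF this] obtain z where
    z: "z \<notin> fvs \<Gamma> \<union> fvs \<Delta> \<union> fv (inst \<psi> s)" "z \<notin> fv_tm s" "Suc z \<notin> fv \<psi>" "Suc (Suc z) \<notin> fv \<phi>"
    by auto
  \<comment> \<open>\<open>w\<close> will be the eigenvariable of (Case), so it is chosen after
    \<open>z\<close> and avoids the whole sequent at the start of the cycle.\<close>
  have "finite (fvs (insert (inst \<psi> s) \<Gamma>) \<union> fvs (insert (inst \<psi> (Var z)) \<Delta>) \<union> fv (RTC \<phi> s (Var z)))"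
    using finite_fv[of "RTC \<phi> s (Var z)"] by (simp add: fin finite_fvs finite_fv del: fv.simps)
  from fresh_nat[OF this] obtain w where
    w: "w \<notin> fvs (insert (inst \<psi> s) \<Gamma>) \<union> fvs (insert (inst \<psi> (Var z)) \<Delta>) \<union> fv (RTC \<phi> s (Var z))"
    by blast
  have wfA: "wf_seq \<Sigma> (insert (RTC \<phi> s (Var z)) (insert (inst \<psi> s) \<Gamma>) \<turnstile> insert (inst \<psi> (Var z)) \<Delta>)"
    using wf wf_fm_inst[OF wf\<psi>] by auto
  \<comment> \<open>The left premise of (Case): rewriting along \<open>s = z\<close> turns an axiom
    for \<open>inst \<psi> s\<close> into the goal.\<close>
  have "CRTC_omega_G \<Sigma> (insert (Eq s (Var z)) (insert (inst \<psi> s) \<Gamma>) \<turnstile> insert (inst \<psi> (Var z)) \<Delta>)"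
    by (rule CRTC_base[OF base_rule.EqL1])
      (use wf wfA in \<open>auto intro!: CRTC_ax[of "inst \<psi> s"]\<close>)
  then obtain L where L: "regular_proof \<Sigma> L"
    "concl L = (insert (Eq s (Var z)) (insert (inst \<psi> s) \<Gamma>) \<turnstile> insert (inst \<psi> (Var z)) \<Delta>)"
    unfolding CRTC_iff by blast
  \<comment> \<open>Moves both eigenvariables of the induction step at once; the side conditions of
    (Ind) keep everything else fixed.\<close>
  define \<theta> :: "nat \<Rightarrow> 'f tm" where "\<theta> = Var(x := Var w, y := Var z)"
  have "CRTC_omega_G \<Sigma>
    (subst \<theta> ` (insert (inst \<psi> (Var x)) (insert (inst2 \<phi> (Var x) (Var y)) \<Gamma>))
      \<turnstile> subst \<theta> ` (insert (inst \<psi> (Var y)) \<Delta>))"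
    by (rule CRTC_rule[OF omega_rule.Subst])
      (use CRTC_wf[OF prem] prem in \<open>auto intro!: wf_fm_subst simp: \<theta>_def\<close>)
  moreover have "subst \<theta> ` \<Gamma> = \<Gamma>" "subst \<theta> ` \<Delta> = \<Delta>"
    using xy by (auto intro!: subst_image_fresh simp: \<theta>_def)
  moreover have "subst \<theta> (inst \<psi> (Var x)) = inst \<psi> (Var w)" "subst \<theta> (inst \<psi> (Var y)) = inst \<psi> (Var z)"
    unfolding subst_inst unfolding inst_def
    by (rule subst_cong; use xy in \<open>auto simp: \<theta>_def split: nat.split\<close>)+
  moreover have "subst \<theta> (inst2 \<phi> (Var x) (Var y)) = inst2 \<phi> (Var w) (Var z)"
    unfolding subst_inst2 unfolding inst2_def
    by (rule subst_cong; use xy in \<open>auto simp: \<theta>_def split: nat.split\<close>)+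
  ultimately obtain R where R: "regular_proof \<Sigma> R"
      "concl R = (insert (inst \<psi> (Var w)) (insert (inst2 \<phi> (Var w) (Var z)) \<Gamma>)
        \<turnstile> insert (inst \<psi> (Var z)) \<Delta>)"
    unfolding CRTC_iff by auto
  define \<rho> :: "nat \<Rightarrow> 'f tm" where "\<rho> = Var(z := t)"
  have A: "CRTC_omega_G \<Sigma>
    (insert (RTC \<phi> s (Var z)) (insert (inst \<psi> s) \<Gamma>) \<turnstile> insert (inst \<psi> (Var z)) \<Delta>)"
    by (rule regular_proof_cycle[OF wfA z w L R])
  have "CRTC_omega_G \<Sigma> (subst \<rho> ` (insert (RTC \<phi> s (Var z)) (insert (inst \<psi> s) \<Gamma>))
      \<turnstile> subst \<rho> ` (insert (inst \<psi> (Var z)) \<Delta>))"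
    by (rule CRTC_rule[OF omega_rule.Subst])
      (use CRTC_wf[OF A] wf A in \<open>auto intro!: wf_fm_subst wf_tm_subst wf_tm_up simp: \<rho>_def\<close>)
  moreover have "subst \<rho> ` \<Gamma> = \<Gamma>" "subst \<rho> ` \<Delta> = \<Delta>"
    using z by (auto intro!: subst_image_fresh simp: \<rho>_def)
  moreover have "subst \<rho> (inst \<psi> s) = inst \<psi> s"
    using z by (intro subst_fresh) (auto simp: \<rho>_def)
  moreover have "subst \<rho> (inst \<psi> (Var z)) = inst \<psi> t"
    unfolding subst_inst unfolding inst_def
    by (rule subst_cong) (use z in \<open>auto simp: \<rho>_def split: nat.split\<close>)
  moreover have "subst (up (up \<rho>)) \<phi> = \<phi>"
    using z by (intro subst_up_up_fresh) (auto simp: \<rho>_def)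
  moreover have "subst_tm \<rho> s = s"
    using z by (intro subst_tm_fresh) (auto simp: \<rho>_def)
  ultimately show ?thesis by (simp add: \<rho>_def insert_commute)
qed

lemma RTC_G_imp_CRTC: "RTC_G \<Sigma> S \<Longrightarrow> CRTC_omega_G \<Sigma> S"
proof (induct rule: RTC_G.induct)
  case (Base Ps S)
  then show ?case by (intro CRTC_base) auto
next
  case (Subst \<Gamma> \<Delta> \<theta>)
  then show ?case by (intro CRTC_rule[OF omega_rule.Subst]) auto
next
  case (Ind \<psi> x \<phi> y \<Gamma> \<Delta> s t)
  show ?case by (rule CRTC_Ind[OF Ind(2-10)])
qed


section \<open>Derived rules\<close>

lemma RTC_G_wf: "RTC_G \<Sigma> S \<Longrightarrow> wf_seq \<Sigma> S"
  by (induct rule: RTC_G.induct) auto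

lemma RTC_G_rule:
  "base_rule Ps S \<Longrightarrow> wf_seq \<Sigma> S \<Longrightarrow> \<forall>P\<in>set Ps. RTC_G \<Sigma> P \<Longrightarrow> RTC_G \<Sigma> S"
  by (rule RTC_G.Base)

lemma RTC_G_weak:
  "RTC_G \<Sigma> (\<Gamma> \<turnstile> \<Delta>) \<Longrightarrow> \<Gamma> \<subseteq> \<Gamma>' \<Longrightarrow> \<Delta> \<subseteq> \<Delta>' \<Longrightarrow> wf_seq \<Sigma> (\<Gamma>' \<turnstile> \<Delta>') \<Longrightarrow> RTC_G \<Sigma> (\<Gamma>' \<turnstile> \<Delta>')"
  by (rule RTC_G_rule[OF base_rule.Weak]) auto

lemma RTC_G_ax:
  assumes "\<Gamma> \<inter> \<Delta> \<noteq> {}" "wf_seq \<Sigma> (\<Gamma> \<turnstile> \<Delta>)"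
  shows "RTC_G \<Sigma> (\<Gamma> \<turnstile> \<Delta>)"
proof -
  obtain \<phi> where \<phi>: "\<phi> \<in> \<Gamma>" "\<phi> \<in> \<Delta>" using assms(1) by blast
  have "RTC_G \<Sigma> ({\<phi>} \<turnstile> {\<phi>})"
    by (rule RTC_G_rule[OF base_rule.Ax]) (use assms(2) \<phi> in auto)
  then show ?thesis by (rule RTC_G_weak) (use assms(2) \<phi> in auto)
qed

text \<open>A cut against the derivable sequent
  \<open>{} \<turnstile> {Neg \<phi>, \<phi>}\<close>.\<close>

lemma RTC_G_NegL_inv:
  assumes "RTC_G \<Sigma> (insert (Neg \<phi>) \<Gamma> \<turnstile> \<Delta>)"
  shows "RTC_G \<Sigma> (\<Gamma> \<turnstile> insert \<phi> \<Delta>)"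
proof -
  note wf = RTC_G_wf[OF assms]
  have "RTC_G \<Sigma> ({} \<turnstile> insert (Neg \<phi>) {\<phi>})"
    by (rule RTC_G_rule[OF base_rule.NegR]) (use wf in \<open>auto simp: RTC_G_ax\<close>)
  then have "RTC_G \<Sigma> ({} \<union> \<Gamma> \<turnstile> {\<phi>} \<union> \<Delta>)"
    by (intro RTC_G_rule[OF base_rule.Cut[of "{}" "Neg \<phi>"]]) (use wf assms in auto)
  then show ?thesis by simp
qed

text \<open>With its converse below, this permits one-sided sequents, so that consistency becomes a
  property of a single set. The induction generalizes \<open>\<Delta>\<close>, which collects the
  formulas already moved.\<close>

lemma RTC_G_neg_image_inv:
  assumes "finite \<Theta>" "RTC_G \<Sigma> (Neg ` \<Theta> \<union> \<Gamma> \<turnstile> \<Delta>)"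
  shows "RTC_G \<Sigma> (\<Gamma> \<turnstile> \<Theta> \<union> \<Delta>)"
  using assms
proof (induct arbitrary: \<Delta>)
  case (insert \<phi> \<Theta>)
  then have "RTC_G \<Sigma> (Neg ` \<Theta> \<union> \<Gamma> \<turnstile> insert \<phi> \<Delta>)"
    by (intro RTC_G_NegL_inv) simp
  then have "RTC_G \<Sigma> (\<Gamma> \<turnstile> \<Theta> \<union> insert \<phi> \<Delta>)" by (rule insert)
  then show ?case by simp
qed simp

lemma RTC_G_neg_image:
  assumes "finite \<Theta>" "RTC_G \<Sigma> (\<Gamma> \<turnstile> \<Theta> \<union> \<Delta>)"
  shows "RTC_G \<Sigma> (Neg ` \<Theta> \<union> \<Gamma> \<turnstile> \<Delta>)"
  using assms
proof (induct arbitrary: \<Delta>)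
  case (insert \<phi> \<Theta>)
  then have IH: "RTC_G \<Sigma> (Neg ` \<Theta> \<union> \<Gamma> \<turnstile> insert \<phi> \<Delta>)" by simp
  then have "RTC_G \<Sigma> (insert (Neg \<phi>) (Neg ` \<Theta> \<union> \<Gamma>) \<turnstile> \<Delta>)"
    by (intro RTC_G_rule[OF base_rule.NegL]) (use RTC_G_wf[OF IH] in auto)
  then show ?case by simp
qed simp


section \<open>Maximal consistent sets with witnesses\<close>

lemma wf_tm_mono: "funs \<Sigma>0 \<subseteq> funs \<Sigma> \<Longrightarrow> wf_tm \<Sigma>0 t \<Longrightarrow> wf_tm \<Sigma> t"
  by (induct t) auto

lemma wf_fm_mono:
  "funs \<Sigma>0 \<subseteq> funs \<Sigma> \<Longrightarrow> preds \<Sigma>0 \<subseteq> preds \<Sigma> \<Longrightarrow> wf_fm \<Sigma>0 \<phi> \<Longrightarrow> wf_fm \<Sigma> \<phi>"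
  by (induct \<phi>) (auto intro: wf_tm_mono)

text \<open>Derivability refers to the full signature \<open>\<Sigma>\<close>, the formulas of
  \<open>H\<close> only to \<open>\<Sigma>0\<close>: the construction enumerates formulas, and
  \<open>\<Sigma>\<close> may be uncountable. Derivable sequents are finite, so consistency of all
  subsets is that of the finite ones.\<close>

locale witnessed_set =
  fixes \<Sigma> \<Sigma>0 :: "('f, 'p) signature" and H :: "('f, 'p) fm set"
  assumes sub: "funs \<Sigma>0 \<subseteq> funs \<Sigma>" "preds \<Sigma>0 \<subseteq> preds \<Sigma>"
    and consistent: "X \<subseteq> H \<Longrightarrow> \<not> RTC_G \<Sigma> (X \<turnstile> {})"
    and H_wf: "\<phi> \<in> H \<Longrightarrow> wf_fm \<Sigma>0 \<phi>"
    and complete: "wf_fm \<Sigma>0 \<phi> \<Longrightarrow> \<phi> \<in> H \<or> Neg \<phi> \<in> H"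
    and Exi_witness: "Exi \<phi> \<in> H \<Longrightarrow> \<exists>y. inst \<phi> (Var y) \<in> H"
    and Uni_witness: "Neg (Uni \<phi>) \<in> H \<Longrightarrow> \<exists>y. Neg (inst \<phi> (Var y)) \<in> H"

text \<open>A finite set leaves some variable fresh, and this can act as the eigenvariable of
  \<open>ExiL\<close> or \<open>AllR\<close>: adding its witness formula then preserves
  consistency.\<close>

lemma consistent_step:
  assumes X: "finite X" "\<forall>\<chi>\<in>X. wf_fm \<Sigma>0 \<chi>" "\<not> RTC_G \<Sigma> (X \<turnstile> {})"
    and \<phi>: "wf_fm \<Sigma>0 \<phi>"
    and sub: "funs \<Sigma>0 \<subseteq> funs \<Sigma>" "preds \<Sigma>0 \<subseteq> preds \<Sigma>"
  shows "\<exists>Y. X \<subseteq> Y \<and> finite Y \<and> (\<forall>\<chi>\<in>Y. wf_fm \<Sigma>0 \<chi>) \<and> \<not> RTC_G \<Sigma> (Y \<turnstile> {}) \<and>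
    (Neg \<phi> \<in> Y \<or> \<phi> \<in> Y \<and> (\<forall>\<psi>. \<phi> = Exi \<psi> \<longrightarrow> (\<exists>y. inst \<psi> (Var y) \<in> Y)) \<and>
      (\<forall>\<psi>. \<phi> = Neg (Uni \<psi>) \<longrightarrow> (\<exists>y. Neg (inst \<psi> (Var y)) \<in> Y)))"
proof -
  let ?Z = "insert \<phi> X"
  have wf: "wf_seq \<Sigma> (?Z \<turnstile> {})" using X \<phi> wf_fm_mono[OF sub] by auto
  have Z: "finite ?Z" "\<forall>\<chi>\<in>?Z. wf_fm \<Sigma>0 \<chi>" using X \<phi> by auto
  show ?thesis
  proof (cases "RTC_G \<Sigma> (?Z \<turnstile> {})")
    case True
    \<comment> \<open>If both \<open>\<phi>\<close> and \<open>Neg \<phi>\<close> were inconsistent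
      with \<open>X\<close>, a cut on \<open>\<phi>\<close> would refute \<open>X\<close>.\<close>
    have "\<not> RTC_G \<Sigma> (insert (Neg \<phi>) X \<turnstile> {})"
    proof
      assume "RTC_G \<Sigma> (insert (Neg \<phi>) X \<turnstile> {})"
      then have "RTC_G \<Sigma> (X \<turnstile> insert \<phi> {})" by (rule RTC_G_NegL_inv)
      then have "RTC_G \<Sigma> (X \<union> X \<turnstile> {} \<union> {})"
        by (intro RTC_G_rule[OF base_rule.Cut[of X \<phi>]]) (use True wf in auto)
      then show False using X by simp
    qed
    then show ?thesis using X \<phi> by (intro exI[of _ "insert (Neg \<phi>) X"]) auto
  next
    case False
    obtain y where y: "y \<notin> fvs ?Z"
      using fresh_nat[OF finite_fvs[OF Z(1)]] by blast
    consider (Exi) \<psi> where "\<phi> = Exi \<psi>" | (Uni) \<psi> where "\<phi> = Neg (Uni \<psi>)"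
      | (other) "\<And>\<psi>. \<phi> \<noteq> Exi \<psi>" "\<And>\<psi>. \<phi> \<noteq> Neg (Uni \<psi>)" by blast
    then show ?thesis
    proof cases
      case Exi
      have "\<not> RTC_G \<Sigma> (insert (inst \<psi> (Var y)) ?Z \<turnstile> {})"
      proof
        assume "RTC_G \<Sigma> (insert (inst \<psi> (Var y)) ?Z \<turnstile> {})"
        then have "RTC_G \<Sigma> (insert (Exi \<psi>) ?Z \<turnstile> {})"
          by (intro RTC_G_rule[OF base_rule.ExiL[of y]]) (use y wf Exi in auto)
        then show False using False Exi by simp
      qed
      then show ?thesis
        using Z Exi \<phi> by (intro exI[of _ "insert (inst \<psi> (Var y)) ?Z"]) (auto intro: wf_fm_inst)
    next
      \<comment> \<open>A refutation of the witness proves the instance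
        \<open>inst \<psi> (Var y)\<close>, hence by generalization \<open>Uni \<psi>\<close>,
        against \<open>Neg (Uni \<psi>)\<close> in \<open>?Z\<close>.\<close>
      case Uni
      have "\<not> RTC_G \<Sigma> (insert (Neg (inst \<psi> (Var y))) ?Z \<turnstile> {})"
      proof
        assume "RTC_G \<Sigma> (insert (Neg (inst \<psi> (Var y))) ?Z \<turnstile> {})"
        then have "RTC_G \<Sigma> (?Z \<turnstile> insert (inst \<psi> (Var y)) {})" by (rule RTC_G_NegL_inv)
        then have "RTC_G \<Sigma> (?Z \<turnstile> insert (Uni \<psi>) {})"
          by (intro RTC_G_rule[OF base_rule.AllR[of y]]) (use y wf Uni in auto)
        then have "RTC_G \<Sigma> (insert (Neg (Uni \<psi>)) ?Z \<turnstile> {})"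
          by (intro RTC_G_rule[OF base_rule.NegL]) (use wf Uni in auto)
        then show False using False Uni by simp
      qed
      then show ?thesis
        using Z Uni \<phi>
        by (intro exI[of _ "insert (Neg (inst \<psi> (Var y))) ?Z"]) (auto intro: wf_fm_inst)
    next
      case other
      then show ?thesis using Z False by (intro exI[of _ ?Z]) auto
    qed
  qed
qed

text \<open>Lindenbaum's construction: run through an enumeration of the formulas, decide each in
  turn and take the union.\<close>

lemma witnessed_set_exists:
  fixes \<Sigma> \<Sigma>0 :: "('f, 'p) signature"
  assumes cnt: "countable {\<phi>. wf_fm \<Sigma>0 \<phi>}"
    and sub: "funs \<Sigma>0 \<subseteq> funs \<Sigma>" "preds \<Sigma>0 \<subseteq> preds \<Sigma>"
    and X0: "finite X0" "\<forall>\<chi>\<in>X0. wf_fm \<Sigma>0 \<chi>" "\<not> RTC_G \<Sigma> (X0 \<turnstile> {})"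
  shows "\<exists>H. X0 \<subseteq> H \<and> witnessed_set \<Sigma> \<Sigma>0 H"
proof -
  define enum where "enum = from_nat_into {\<phi>. wf_fm \<Sigma>0 \<phi>}"
  have ne: "{\<phi>. wf_fm \<Sigma>0 \<phi>} \<noteq> {}"
    using wf_fm.simps(1)[of \<Sigma>0 "Var 0" "Var 0"] by (metis empty_Collect_eq wf_tm.simps(1))
  have wf_enum: "wf_fm \<Sigma>0 (enum n)" for n
    using from_nat_into[OF ne, of n] by (simp add: enum_def)
  have enum_surj: "\<exists>n. enum n = \<phi>" if "wf_fm \<Sigma>0 \<phi>" for \<phi>
    using from_nat_into_surj[OF cnt] that by (simp add: enum_def)
  define P where "P X \<longleftrightarrow>
    X0 \<subseteq> X \<and> finite X \<and> (\<forall>\<chi>\<in>X. wf_fm \<Sigma>0 \<chi>) \<and> \<not> RTC_G \<Sigma> (X \<turnstile> {})" for X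
  define Q where "Q \<phi> Y \<longleftrightarrow>
    Neg \<phi> \<in> Y \<or> \<phi> \<in> Y \<and> (\<forall>\<psi>. \<phi> = Exi \<psi> \<longrightarrow> (\<exists>y. inst \<psi> (Var y) \<in> Y)) \<and>
      (\<forall>\<psi>. \<phi> = Neg (Uni \<psi>) \<longrightarrow> (\<exists>y. Neg (inst \<psi> (Var y)) \<in> Y))" for \<phi> and Y :: "('f, 'p) fm set"
  have "\<exists>F. \<forall>n::nat. P (F n) \<and> (F n \<subseteq> F (Suc n) \<and> Q (enum n) (F (Suc n)))"
  proof (rule dependent_nat_choice)
    show "\<exists>X. P X" using X0 by (auto simp: P_def)
  next
    fix X and n :: nat assume "P X"
    then have X: "X0 \<subseteq> X" "finite X" "\<forall>\<chi>\<in>X. wf_fm \<Sigma>0 \<chi>" "\<not> RTC_G \<Sigma> (X \<turnstile> {})"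
      by (simp_all add: P_def)
    obtain Y where "X \<subseteq> Y" "finite Y" "\<forall>\<chi>\<in>Y. wf_fm \<Sigma>0 \<chi>" "\<not> RTC_G \<Sigma> (Y \<turnstile> {})" "Q (enum n) Y"
      using consistent_step[OF X(2-4) wf_enum[of n] sub, folded Q_def] by blast
    then show "\<exists>Y. P Y \<and> (X \<subseteq> Y \<and> Q (enum n) Y)"
      using X(1) unfolding P_def by blast
  qed
  then obtain F where F: "\<And>n. P (F n)" "\<And>n. F n \<subseteq> F (Suc n)" "\<And>n. Q (enum n) (F (Suc n))"
    by blast
  define H where "H = (\<Union>n. F n)"
  \<comment> \<open>The stages form a chain, so a finite part of the union lies in one stage; this
    reduces consistency of \<open>H\<close> to that of the stages.\<close>
  have fin_sub: "\<exists>n. X \<subseteq> F n" if "finite X" "X \<subseteq> H" for X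
    using that
  proof (induct)
    case (insert \<phi> X)
    then obtain n k where "X \<subseteq> F n" "\<phi> \<in> F k" by (auto simp: H_def)
    moreover have "F n \<subseteq> F (max n k)" "F k \<subseteq> F (max n k)"
      by (rule lift_Suc_mono_le[of F, OF F(2)], simp)+
    ultimately show ?case by (intro exI[of _ "max n k"]) auto
  qed simp
  have cons: "\<not> RTC_G \<Sigma> (X \<turnstile> {})" if "X \<subseteq> H" for X
  proof
    assume prov: "RTC_G \<Sigma> (X \<turnstile> {})"
    have "finite X" using RTC_G_wf[OF prov] by simp
    from fin_sub[OF this that] obtain n where n: "X \<subseteq> F n" ..
    have "wf_seq \<Sigma> (F n \<turnstile> {})"
      using F(1)[of n] wf_fm_mono[OF sub] unfolding P_def wf_seq_simp by blast
    then have "RTC_G \<Sigma> (F n \<turnstile> {})" by (intro RTC_G_weak[OF prov n]) simp_all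
    then show False using F(1)[of n] by (simp add: P_def)
  qed
  have wfH: "wf_fm \<Sigma>0 \<phi>" if "\<phi> \<in> H" for \<phi>
    using that F(1) unfolding H_def P_def by blast
  \<comment> \<open>Being decided with witnesses persists in larger sets, so the stage following the
    index of \<open>\<phi>\<close> settles it for \<open>H\<close>.\<close>
  have QH: "Neg \<phi> \<in> H \<or> Q \<phi> H \<and> \<phi> \<in> H" if "wf_fm \<Sigma>0 \<phi>" for \<phi>
  proof -
    from enum_surj[OF that] obtain n where "enum n = \<phi>" ..
    then have "Q \<phi> (F (Suc n))" using F(3)[of n] by simp
    moreover have "F (Suc n) \<subseteq> H" by (auto simp: H_def)
    ultimately show ?thesis unfolding Q_def by blast
  qed
  \<comment> \<open>Rules out the alternative \<open>Neg \<phi> \<in> H\<close> for members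
    \<open>\<phi>\<close> of \<open>H\<close>, so that these do have their witnesses.\<close>
  have contra: "\<not> (\<phi> \<in> H \<and> Neg \<phi> \<in> H)" for \<phi>
  proof
    assume *: "\<phi> \<in> H \<and> Neg \<phi> \<in> H"
    then have "wf_fm \<Sigma> \<phi>" using wfH wf_fm_mono[OF sub] by blast
    then have "RTC_G \<Sigma> (insert (Neg \<phi>) {\<phi>} \<turnstile> {})"
      by (intro RTC_G_rule[OF base_rule.NegL]) (auto simp: RTC_G_ax)
    then show False using cons[of "{Neg \<phi>, \<phi>}"] * by simp
  qed
  have "witnessed_set \<Sigma> \<Sigma>0 H"
  proof
    show "\<exists>y. inst \<phi> (Var y) \<in> H" if "Exi \<phi> \<in> H" for \<phi>
      using QH[OF wfH[OF that]] contra that by (auto simp: Q_def)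
    show "\<exists>y. Neg (inst \<phi> (Var y)) \<in> H" if "Neg (Uni \<phi>) \<in> H" for \<phi>
      using QH[OF wfH[OF that]] contra that by (auto simp: Q_def)
  qed (use sub cons wfH QH in blast)+
  moreover have "X0 \<subseteq> H" using F(1)[of 0] by (auto simp: H_def P_def)
  ultimately show ?thesis by blast
qed


section \<open>The canonical Henkin structure\<close>

context witnessed_set
begin

section \<open>Closure of \<open>H\<close> under the logical rules\<close>

lemma wf0: "wf_fm \<Sigma>0 \<phi> \<Longrightarrow> wf_fm \<Sigma> \<phi>" "wf_tm \<Sigma>0 t \<Longrightarrow> wf_tm \<Sigma> t"
  using wf_fm_mono wf_tm_mono sub by blast+

text \<open>Otherwise completeness puts all negations of \<open>\<Delta>\<close> into
  \<open>H\<close>, and moving \<open>\<Delta>\<close> to the left exhibits an inconsistent subset.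
  Each derivable sequent thus becomes a closure property of \<open>H\<close>.\<close>

lemma sequent_holds:
  assumes "RTC_G \<Sigma> (\<Gamma> \<turnstile> \<Delta>)" "\<Gamma> \<subseteq> H" "\<forall>\<delta>\<in>\<Delta>. wf_fm \<Sigma>0 \<delta>"
  shows "\<exists>\<delta>\<in>\<Delta>. \<delta> \<in> H"
proof (rule ccontr)
  assume "\<not> ?thesis"
  then have "Neg ` \<Delta> \<union> \<Gamma> \<subseteq> H" using complete assms by blast
  moreover have "finite \<Delta>" using RTC_G_wf[OF assms(1)] by simp
  then have "RTC_G \<Sigma> (Neg ` \<Delta> \<union> \<Gamma> \<turnstile> {})" using assms by (intro RTC_G_neg_image) auto
  ultimately show False using consistent by blast
qed

lemma entails: "RTC_G \<Sigma> (\<Gamma> \<turnstile> {\<phi>}) \<Longrightarrow> \<Gamma> \<subseteq> H \<Longrightarrow> wf_fm \<Sigma>0 \<phi> \<Longrightarrow> \<phi> \<in> H"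
  using sequent_holds[of \<Gamma> "{\<phi>}"] by simp

lemma Neg_iff: "wf_fm \<Sigma>0 \<phi> \<Longrightarrow> Neg \<phi> \<in> H \<longleftrightarrow> \<phi> \<notin> H"
proof -
  assume wf: "wf_fm \<Sigma>0 \<phi>"
  have "RTC_G \<Sigma> (insert (Neg \<phi>) {\<phi>} \<turnstile> {})"
    by (rule RTC_G_rule[OF base_rule.NegL]) (use wf0 wf in \<open>auto simp: RTC_G_ax\<close>)
  then show ?thesis using consistent[of "{Neg \<phi>, \<phi>}"] complete[OF wf] by blast
qed

lemma Con_iff:
  assumes "wf_fm \<Sigma>0 \<phi>" "wf_fm \<Sigma>0 \<psi>"
  shows "Con \<phi> \<psi> \<in> H \<longleftrightarrow> \<phi> \<in> H \<and> \<psi> \<in> H"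
proof -
  note wf = assms[THEN wf0(1)]
  have L1: "RTC_G \<Sigma> ({Con \<phi> \<psi>} \<turnstile> {\<phi>})" and L2: "RTC_G \<Sigma> ({Con \<phi> \<psi>} \<turnstile> {\<psi>})"
    by (rule RTC_G_rule[OF base_rule.ConL]; use wf in \<open>simp add: RTC_G_ax\<close>)+
  have R: "RTC_G \<Sigma> ({\<phi>, \<psi>} \<turnstile> {Con \<phi> \<psi>})"
    by (rule RTC_G_rule[OF base_rule.ConR]; use wf in \<open>simp add: RTC_G_ax\<close>)
  have "Con \<phi> \<psi> \<in> H \<Longrightarrow> \<phi> \<in> H" using entails[OF L1] assms by simp
  moreover have "Con \<phi> \<psi> \<in> H \<Longrightarrow> \<psi> \<in> H" using entails[OF L2] assms by simp
  moreover have "\<phi> \<in> H \<Longrightarrow> \<psi> \<in> H \<Longrightarrow> Con \<phi> \<psi> \<in> H" using entails[OF R] assms by simp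
  ultimately show ?thesis by blast
qed

lemma Dis_iff:
  assumes "wf_fm \<Sigma>0 \<phi>" "wf_fm \<Sigma>0 \<psi>"
  shows "Dis \<phi> \<psi> \<in> H \<longleftrightarrow> \<phi> \<in> H \<or> \<psi> \<in> H"
proof -
  note wf = assms[THEN wf0(1)]
  have R1: "RTC_G \<Sigma> ({\<phi>} \<turnstile> {Dis \<phi> \<psi>})" and R2: "RTC_G \<Sigma> ({\<psi>} \<turnstile> {Dis \<phi> \<psi>})"
    by (rule RTC_G_rule[OF base_rule.DisR]; use wf in \<open>simp add: RTC_G_ax\<close>)+
  have L: "RTC_G \<Sigma> ({Dis \<phi> \<psi>} \<turnstile> {\<phi>, \<psi>})"
    by (rule RTC_G_rule[OF base_rule.DisL]; use wf in \<open>simp add: RTC_G_ax\<close>)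
  have "Dis \<phi> \<psi> \<in> H \<Longrightarrow> \<phi> \<in> H \<or> \<psi> \<in> H" using sequent_holds[OF L] assms by simp
  moreover have "\<phi> \<in> H \<Longrightarrow> Dis \<phi> \<psi> \<in> H" using entails[OF R1] assms by simp
  moreover have "\<psi> \<in> H \<Longrightarrow> Dis \<phi> \<psi> \<in> H" using entails[OF R2] assms by simp
  ultimately show ?thesis by blast
qed

lemma Imp_iff:
  assumes "wf_fm \<Sigma>0 \<phi>" "wf_fm \<Sigma>0 \<psi>"
  shows "Imp \<phi> \<psi> \<in> H \<longleftrightarrow> (\<phi> \<in> H \<longrightarrow> \<psi> \<in> H)"
proof -
  note wf = assms[THEN wf0(1)]
  have R1: "RTC_G \<Sigma> ({\<psi>} \<turnstile> {Imp \<phi> \<psi>})" and R2: "RTC_G \<Sigma> ({} \<turnstile> {Imp \<phi> \<psi>, \<phi>})"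
    by (rule RTC_G_rule[OF base_rule.ImpR]; use wf in \<open>simp add: RTC_G_ax\<close>)+
  have L: "RTC_G \<Sigma> ({Imp \<phi> \<psi>, \<phi>} \<turnstile> {\<psi>})"
    by (rule RTC_G_rule[OF base_rule.ImpL]; use wf in \<open>simp add: RTC_G_ax\<close>)
  have "Imp \<phi> \<psi> \<in> H \<Longrightarrow> \<phi> \<in> H \<Longrightarrow> \<psi> \<in> H" using entails[OF L] assms by simp
  moreover have "\<psi> \<in> H \<Longrightarrow> Imp \<phi> \<psi> \<in> H" using entails[OF R1] assms by simp
  moreover have "Imp \<phi> \<psi> \<in> H \<or> \<phi> \<in> H" using sequent_holds[OF R2] assms by simp
  ultimately show ?thesis by blast
qed

lemma Exi_I:
  assumes "wf_fm \<Sigma>0 \<phi>" "wf_tm \<Sigma>0 t" "inst \<phi> t \<in> H"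
  shows "Exi \<phi> \<in> H"
proof -
  have "RTC_G \<Sigma> ({inst \<phi> t} \<turnstile> {Exi \<phi>})"
    by (rule RTC_G_rule[OF base_rule.ExiR[of _ _ t]])
      (use assms(1,2) in \<open>auto simp: RTC_G_ax wf_fm_inst wf0\<close>)
  from entails[OF this] show ?thesis using assms by simp
qed

lemma Uni_D:
  assumes "Uni \<phi> \<in> H" "wf_tm \<Sigma>0 t"
  shows "inst \<phi> t \<in> H"
proof -
  have wf: "wf_fm \<Sigma>0 \<phi>" using H_wf[OF assms(1)] by simp
  have "RTC_G \<Sigma> ({Uni \<phi>} \<turnstile> {inst \<phi> t})"
    by (rule RTC_G_rule[OF base_rule.AllL[of _ t]])
      (use wf assms in \<open>auto simp: RTC_G_ax wf_fm_inst wf0\<close>)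
  from entails[OF this] show ?thesis using assms wf by (simp add: wf_fm_inst)
qed

lemma Exi_iff: "wf_fm \<Sigma>0 \<phi> \<Longrightarrow> Exi \<phi> \<in> H \<longleftrightarrow> (\<exists>y. inst \<phi> (Var y) \<in> H)"
  using Exi_witness Exi_I[of \<phi> "Var _"] by auto

lemma Uni_iff: "wf_fm \<Sigma>0 \<phi> \<Longrightarrow> Uni \<phi> \<in> H \<longleftrightarrow> (\<forall>y. inst \<phi> (Var y) \<in> H)"
  using Uni_witness[of \<phi>] Uni_D[of \<phi> "Var _"] Neg_iff[of "Uni \<phi>"] Neg_iff[OF wf_fm_inst[of \<Sigma>0 \<phi>]]
  by (metis wf_fm.simps(7) wf_tm.simps(1))

section \<open>Equality in \<open>H\<close> is a congruence\<close>

lemma Eq_refl: "wf_tm \<Sigma>0 t \<Longrightarrow> Eq t t \<in> H"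
  using entails[of "{}" "Eq t t"] RTC_G_rule[OF base_rule.EqR[of t], of \<Sigma>] wf0(2)[of t]
  by simp

text \<open>Leibniz's law for \<open>H\<close>, obtained from \<open>EqL1\<close>; the schema
  \<open>\<phi>\<close> has its hole at index 0.\<close>

lemma Eq_inst:
  assumes "Eq s t \<in> H" "inst \<phi> s \<in> H"
  shows "inst \<phi> t \<in> H"
proof -
  have wf: "wf_tm \<Sigma>0 s" "wf_tm \<Sigma>0 t" "wf_fm \<Sigma>0 \<phi>"
    using H_wf[OF assms(1)] H_wf[OF assms(2)] wf_fm_inst_rev by auto
  have "RTC_G \<Sigma> ({Eq s t, inst \<phi> s} \<turnstile> {inst \<phi> t})"
    by (rule RTC_G_rule[OF base_rule.EqL1])
      (use wf in \<open>auto simp: RTC_G_ax wf_fm_inst wf0\<close>)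
  from entails[OF this] show ?thesis using assms wf by (simp add: wf_fm_inst)
qed

text \<open>Makes room for a hole at index 0 when a term is placed inside a schema; instantiation
  undoes it.\<close>

abbreviation lift :: "'f tm \<Rightarrow> 'f tm" where
  "lift \<equiv> subst_tm (\<lambda>k. Var (Suc k))"

lemma subst_tm_lift [simp]: "subst_tm (case_nat u Var) (lift t) = t"
  by (simp add: subst_tm_subst_tm subst_tm_Var)

lemma wf_lift: "wf_tm \<Sigma>0 t \<Longrightarrow> wf_tm \<Sigma>0 (lift t)"
  by (rule wf_tm_subst) auto

lemma Eq_sym: "Eq s t \<in> H \<Longrightarrow> Eq t s \<in> H"
  using Eq_inst[of s t "Eq (Var 0) (lift s)"] Eq_refl[of s] H_wf[of "Eq s t"]
  by (simp add: inst_def)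

lemma Eq_trans: "Eq r s \<in> H \<Longrightarrow> Eq s t \<in> H \<Longrightarrow> Eq r t \<in> H"
  using Eq_inst[of s t "Eq (lift r) (Var 0)"] by (simp add: inst_def)

text \<open>Arguments are replaced one at a time, \<open>us\<close> holding those already done.
  \<open>C\<close> will be a predicate or an equation with a function term.\<close>

lemma Eq_list:
  assumes step: "\<And>us vs s t. Eq s t \<in> H \<Longrightarrow> C (us @ s # vs) \<in> H \<Longrightarrow> C (us @ t # vs) \<in> H"
    and eq: "list_all2 (\<lambda>s t. Eq s t \<in> H) ss ts"
    and C: "C (us @ ss) \<in> H"
  shows "C (us @ ts) \<in> H"
  using eq C
proof (induct ss ts arbitrary: us rule: list_all2_induct)
  case (Cons s ss t ts)
  then have "C (us @ t # ss) \<in> H" using step by blast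
  then show ?case using Cons(3)[of "us @ [t]"] by simp
qed simp

lemma map_subst_tm_lift [simp]: "map (subst_tm (case_nat u Var) \<circ> lift) ts = ts"
  by (simp add: o_def)

lemma Pred_list:
  assumes "list_all2 (\<lambda>s t. Eq s t \<in> H) ss ts" "Pred p ss \<in> H"
  shows "Pred p ts \<in> H"
proof -
  have "Pred p (us @ t # vs) \<in> H" if "Eq s t \<in> H" "Pred p (us @ s # vs) \<in> H" for us vs s t
    using Eq_inst[OF that(1), of "Pred p (map lift us @ Var 0 # map lift vs)"] that(2)
    by (simp add: inst_def)
  then show ?thesis using Eq_list[of "Pred p" ss ts "[]"] assms by simp
qed

lemma Fun_list:
  assumes "list_all2 (\<lambda>s t. Eq s t \<in> H) ss ts" "wf_tm \<Sigma>0 (Fun f ss)"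
  shows "Eq (Fun f ss) (Fun f ts) \<in> H"
proof -
  have "Eq r (Fun f (us @ t # vs)) \<in> H" if "Eq s t \<in> H" "Eq r (Fun f (us @ s # vs)) \<in> H"
    for r us vs s t
    using Eq_inst[OF that(1), of "Eq (lift r) (Fun f (map lift us @ Var 0 # map lift vs))"] that(2)
    by (simp add: inst_def)
  then show ?thesis
    using Eq_list[of "\<lambda>xs. Eq (Fun f ss) (Fun f xs)" ss ts "[]"] assms Eq_refl by simp
qed

section \<open>RTC formulas in \<open>H\<close>\<close>

lemma RTC_refl:
  assumes "wf_fm \<Sigma>0 \<phi>" "wf_tm \<Sigma>0 s"
  shows "RTC \<phi> s s \<in> H"
proof -
  have "RTC_G \<Sigma> ({} \<turnstile> {RTC \<phi> s s})"
    by (rule RTC_G_rule[OF base_rule.Refl]) (use assms wf0 in auto)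
  from entails[OF this] show ?thesis using assms by simp
qed

lemma RTC_step:
  assumes "RTC \<phi> s r \<in> H" "inst2 \<phi> r t \<in> H" "wf_tm \<Sigma>0 t"
  shows "RTC \<phi> s t \<in> H"
proof -
  note wf = H_wf[OF assms(1)] H_wf[OF assms(2)] assms(3)
  have "RTC_G \<Sigma> ({RTC \<phi> s r, inst2 \<phi> r t} \<turnstile> {RTC \<phi> s t})"
    by (rule RTC_G_rule[OF base_rule.Trans[of _ _ _ r]])
      (use wf in \<open>auto simp: RTC_G_ax wf0\<close>)
  from entails[OF this] show ?thesis using assms wf by simp
qed

text \<open>
  The closure of \<open>\<psi>\<close> under \<open>\<phi>\<close> is a side formula without free occurrences of the eigenvariables,
  so that (Ind) applies to it.
\<close>

lemma RTC_induct:
  assumes RTC: "RTC \<phi> s t \<in> H" and \<psi>: "inst \<psi> s \<in> H"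
    and closed: "\<And>i j. inst \<psi> (Var i) \<in> H \<Longrightarrow> inst2 \<phi> (Var i) (Var j) \<in> H \<Longrightarrow> inst \<psi> (Var j) \<in> H"
  shows "inst \<psi> t \<in> H"
proof -
  have wf: "wf_fm \<Sigma>0 \<phi>" "wf_tm \<Sigma>0 s" "wf_tm \<Sigma>0 t" "wf_fm \<Sigma>0 \<psi>"
    using H_wf[OF RTC] H_wf[OF \<psi>] wf_fm_inst_rev by auto
  define sh :: "nat \<Rightarrow> 'f tm" where "sh n = Var (Suc (Suc n))" for n
  \<comment> \<open>The outer quantifier is the source, at index 1, the inner one the target, at
    index 0; \<open>sh\<close> moves the parameters past both.\<close>
  define B where "B = Imp (subst (case_nat (Var 1) sh) \<psi>)
    (Imp (subst (case_nat (Var 1) (case_nat (Var 0) sh)) \<phi>) (subst (case_nat (Var 0) sh) \<psi>))"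
  have wfB: "wf_fm \<Sigma>0 B"
    using wf by (auto simp: B_def sh_def intro!: wf_fm_subst split: nat.split)
  have B_inst: "inst (subst (up (case_nat (Var i) Var)) B) (Var j) =
    Imp (inst \<psi> (Var i)) (Imp (inst2 \<phi> (Var i) (Var j)) (inst \<psi> (Var j)))" for i j
    unfolding inst_subst_up B_def
    by (auto simp: inst_def inst2_def subst_subst sh_def intro!: subst_cong split: nat.split)
  let ?C = "Uni (Uni B)"
  have inst_C: "inst (Uni B) (Var i) = Uni (subst (up (case_nat (Var i) Var)) B)" for i
    by (simp add: inst_def)
  have wf_up_B: "wf_fm \<Sigma>0 (subst (up (case_nat (Var i) Var)) B)" for i
    by (intro wf_fm_subst wfB wf_tm_up) (auto split: nat.split)
  \<comment> \<open>Universal formulas in \<open>H\<close> are determined by their variable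
    instances, so closure at variables suffices.\<close>
  have "?C \<in> H"
    using wfB wf_up_B wf closed
    by (simp add: Uni_iff inst_C B_inst Imp_iff wf_fm_inst wf_fm_inst2)
  have fin: "finite (fv ?C \<union> {n. Suc n \<in> fv \<psi>} \<union> {n. Suc (Suc n) \<in> fv \<phi>})"
    by (simp add: finite_fv finite_pred_image finite_pred_image2 del: fv.simps)
  obtain x where x: "x \<notin> fv ?C \<union> {n. Suc n \<in> fv \<psi>} \<union> {n. Suc (Suc n) \<in> fv \<phi>}"
    using fresh_nat[OF fin] by blast
  obtain y where y: "y \<notin> insert x (fv ?C \<union> {n. Suc n \<in> fv \<psi>} \<union> {n. Suc (Suc n) \<in> fv \<phi>})"
    using fresh_nat[OF finite.insertI[OF fin]] by blast
  note wfs = wf(2,3)[THEN wf0(2)] wf(1,4)[THEN wf0(1)] wf0(1)[OF wfB]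
  let ?\<Gamma> = "{inst \<psi> (Var x), inst2 \<phi> (Var x) (Var y)}"
  have wf_inst: "wf_fm \<Sigma> (inst \<psi> (Var n))" "wf_fm \<Sigma> (inst2 \<phi> (Var n) (Var k))" for n k
    using wfs by (auto intro!: wf_fm_inst wf_fm_inst2)
  \<comment> \<open>Two uses of \<open>ImpL\<close> and two of \<open>AllL\<close> derive the
    premise of (Ind) with \<open>?C\<close> as its side formula.\<close>
  have "RTC_G \<Sigma> (insert (Imp (inst2 \<phi> (Var x) (Var y)) (inst \<psi> (Var y))) ?\<Gamma> \<turnstile> {inst \<psi> (Var y)})"
    by (rule RTC_G_rule[OF base_rule.ImpL]) (use wf_inst in \<open>simp_all add: RTC_G_ax\<close>)
  then have "RTC_G \<Sigma> (insert (inst (subst (up (case_nat (Var x) Var)) B) (Var y)) ?\<Gamma> \<turnstile> {inst \<psi> (Var y)})"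
    unfolding B_inst
    by (intro RTC_G_rule[OF base_rule.ImpL]) (use wf_inst in \<open>simp_all add: RTC_G_ax\<close>)
  then have "RTC_G \<Sigma> (insert (Uni (subst (up (case_nat (Var x) Var)) B)) ?\<Gamma> \<turnstile> {inst \<psi> (Var y)})"
    by (intro RTC_G_rule[OF base_rule.AllL[of _ "Var y"]])
      (use wf_inst wf0(1)[OF wf_up_B] in auto)
  then have "RTC_G \<Sigma> (insert ?C ?\<Gamma> \<turnstile> {inst \<psi> (Var y)})"
    unfolding inst_C[symmetric]
    by (intro RTC_G_rule[OF base_rule.AllL[of _ "Var x"]]) (use wf_inst wfs in auto)
  then have "RTC_G \<Sigma> (insert (inst \<psi> (Var x)) (insert (inst2 \<phi> (Var x) (Var y)) {?C})
    \<turnstile> insert (inst \<psi> (Var y)) {})"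
    by (simp add: insert_commute)
  then have "RTC_G \<Sigma> (insert (inst \<psi> s) (insert (RTC \<phi> s t) {?C}) \<turnstile> insert (inst \<psi> t) {})"
    by (rule RTC_G.Ind) (use x y wf wfs in \<open>auto intro!: wf_fm_inst wf0\<close>)
  then show ?thesis
    using entails[of "{inst \<psi> s, RTC \<phi> s t, ?C}" "inst \<psi> t"] \<open>?C \<in> H\<close> RTC \<psi>
      wf_fm_inst[OF wf(4,3)] by simp
qed

end

text \<open>The variable \<open>k\<close> stands for the element that interprets the function symbols outside of \<open>\<Sigma>\<close>.\<close>

fun erase_tm :: "('f, 'p) signature \<Rightarrow> nat \<Rightarrow> 'f tm \<Rightarrow> 'f tm" where
  "erase_tm \<Sigma> k (Var n) = Var n"
| "erase_tm \<Sigma> k (Fun f ts) =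
     (if (f, length ts) \<in> funs \<Sigma> then Fun f (map (erase_tm \<Sigma> k) ts) else Var k)"

text \<open>Under a binder \<open>k\<close> is raised so as to name the same outer variable. The
  negated equation is a falsehood, matching the empty predicate.\<close>

fun erase :: "('f, 'p) signature \<Rightarrow> nat \<Rightarrow> ('f, 'p) fm \<Rightarrow> ('f, 'p) fm" where
  "erase \<Sigma> k (Eq s t) = Eq (erase_tm \<Sigma> k s) (erase_tm \<Sigma> k t)"
| "erase \<Sigma> k (Pred p ts) =
     (if (p, length ts) \<in> preds \<Sigma> then Pred p (map (erase_tm \<Sigma> k) ts)
      else Neg (Eq (Var k) (Var k)))"
| "erase \<Sigma> k (Neg \<phi>) = Neg (erase \<Sigma> k \<phi>)"
| "erase \<Sigma> k (Con \<phi> \<psi>) = Con (erase \<Sigma> k \<phi>) (erase \<Sigma> k \<psi>)"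
| "erase \<Sigma> k (Dis \<phi> \<psi>) = Dis (erase \<Sigma> k \<phi>) (erase \<Sigma> k \<psi>)"
| "erase \<Sigma> k (Imp \<phi> \<psi>) = Imp (erase \<Sigma> k \<phi>) (erase \<Sigma> k \<psi>)"
| "erase \<Sigma> k (Uni \<phi>) = Uni (erase \<Sigma> (Suc k) \<phi>)"
| "erase \<Sigma> k (Exi \<phi>) = Exi (erase \<Sigma> (Suc k) \<phi>)"
| "erase \<Sigma> k (RTC \<phi> s t) =
     RTC (erase \<Sigma> (Suc (Suc k)) \<phi>) (erase_tm \<Sigma> k s) (erase_tm \<Sigma> k t)"

lemma wf_erase_tm: "wf_tm \<Sigma> (erase_tm \<Sigma> k t)"
  by (induct t) auto

lemma wf_erase: "wf_fm \<Sigma> (erase \<Sigma> k \<phi>)"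
  by (induct \<phi> arbitrary: k) (auto simp: wf_erase_tm)

section \<open>Coincidence: values depend only on the free variables\<close>

lemma eval_cong: "(\<And>n. n \<in> fv_tm t \<Longrightarrow> v n = w n) \<Longrightarrow> eval M v t = eval M w t"
proof (induct t)
  case (Fun f ts)
  then have "map (eval M v) ts = map (eval M w) ts" by auto
  then show ?case by (simp del: map_eq_conv)
qed simp

lemma case_nat_cong:
  "(\<And>n. Suc n \<in> A \<Longrightarrow> v n = w n) \<Longrightarrow> n \<in> A \<Longrightarrow> case_nat a v n = case_nat a w n"
  by (cases n) auto

lemma sat_cong: "(\<And>n. n \<in> fv \<phi> \<Longrightarrow> v n = w n) \<Longrightarrow> sat M v \<phi> = sat M w \<phi>"
proof (induct \<phi> arbitrary: v w)
  case (Eq s t)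
  then show ?case using eval_cong[of s v w M] eval_cong[of t v w M] by simp
next
  case (Pred p ts)
  then have "map (eval M v) ts = map (eval M w) ts" by (auto intro!: eval_cong)
  then show ?case by (simp del: map_eq_conv)
next
  case (Uni \<phi>)
  have "sat M (case_nat a v) \<phi> = sat M (case_nat a w) \<phi>" for a
    by (rule Uni(1), rule case_nat_cong) (use Uni(2) in auto)
  then show ?case by simp
next
  case (Exi \<phi>)
  have "sat M (case_nat a v) \<phi> = sat M (case_nat a w) \<phi>" for a
    by (rule Exi(1), rule case_nat_cong) (use Exi(2) in auto)
  then show ?case by simp
next
  case (RTC \<phi> s t)
  have "sat M (case_nat a (case_nat b v)) \<phi> = sat M (case_nat a (case_nat b w)) \<phi>" for a b
    by (rule RTC(1), rule case_nat_cong, rule case_nat_cong[of "{n. Suc n \<in> fv \<phi>}"])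
      (use RTC(2) in auto)
  moreover have "eval M v s = eval M w s" "eval M v t = eval M w t"
    using RTC(2) by (auto intro!: eval_cong)
  ultimately show ?case by simp
next
  case (Neg \<phi>)
  show ?case using Neg(1)[of v w] Neg(2) by simp
next
  case (Con \<phi> \<psi>)
  show ?case using Con(1,2)[of v w] Con(3) by simp
next
  case (Dis \<phi> \<psi>)
  show ?case using Dis(1,2)[of v w] Dis(3) by simp
next
  case (Imp \<phi> \<psi>)
  show ?case using Imp(1,2)[of v w] Imp(3) by simp
qed

section \<open>The model built from classes of variables and its truth lemma\<close>

locale canonical_model = witnessed_set \<Sigma> \<Sigma>0 H
  for \<Sigma> \<Sigma>0 :: "('f, 'p) signature" and H +
  fixes e :: "nat \<Rightarrow> 'd"
  assumes inj_e: "inj e"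
begin

text \<open>Every term equals a variable in \<open>H\<close>, so numbers suffice as names of the elements.\<close>

definition rep :: "'f tm \<Rightarrow> nat" where
  "rep t = (LEAST n. Eq t (Var n) \<in> H)"

text \<open>\<open>e\<close> carries the names into the prescribed type \<open>'d\<close>.\<close>

definition m :: "'f tm \<Rightarrow> 'd" where
  "m t = e (rep t)"

text \<open>Index 0 of \<open>\<psi>\<close> is the argument; the other indices are parameters, each
  naming the class of a variable.\<close>

definition ext :: "('f, 'p) fm \<Rightarrow> 'd set" where
  "ext \<psi> = {m (Var n) |n. inst \<psi> (Var n) \<in> H}"

text \<open>\<open>inv e a\<close> is the least variable in the class \<open>a\<close>, so the
  symbols of \<open>\<Sigma>0\<close> are read off \<open>H\<close> by applying them to
  names.\<close>

definition M :: "('f, 'p, 'd) frame" where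
  "M = \<lparr>carrier = range (\<lambda>n. m (Var n)),
    fint = \<lambda>f as. if (f, length as) \<in> funs \<Sigma>0 then m (Fun f (map (\<lambda>a. Var (inv e a)) as))
      else m (Var 0),
    pint = \<lambda>p as. (p, length as) \<in> preds \<Sigma>0 \<and> Pred p (map (\<lambda>a. Var (inv e a)) as) \<in> H,
    admissible = {ext \<psi> |\<psi>. wf_fm \<Sigma>0 \<psi>}\<rparr>"

lemma M_simps [simp]:
  "carrier M = range (\<lambda>n. m (Var n))"
  "fint M f as = (if (f, length as) \<in> funs \<Sigma>0 then m (Fun f (map (\<lambda>a. Var (inv e a)) as))
      else m (Var 0))"
  "pint M p as = ((p, length as) \<in> preds \<Sigma>0 \<and> Pred p (map (\<lambda>a. Var (inv e a)) as) \<in> H)"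
  "admissible M = {ext \<psi> |\<psi>. wf_fm \<Sigma>0 \<psi>}"
  by (simp_all add: M_def)

lemma inv_m: "inv e (m t) = rep t"
  by (simp add: m_def inj_e)

text \<open>From \<open>t = t\<close> follows that something equals \<open>t\<close>, and the
  witness for this existential formula in \<open>H\<close> is a variable.\<close>

lemma Eq_rep: assumes "wf_tm \<Sigma>0 t" shows "Eq t (Var (rep t)) \<in> H"
proof -
  have "inst (Eq (lift t) (Var 0)) t \<in> H" using Eq_refl[OF assms] by (simp add: inst_def)
  then have "Exi (Eq (lift t) (Var 0)) \<in> H"
    using assms wf_lift by (intro Exi_I[of _ t]) auto
  then obtain n where "inst (Eq (lift t) (Var 0)) (Var n) \<in> H" using Exi_witness by blast
  then have "Eq t (Var n) \<in> H" by (simp add: inst_def)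
  then show ?thesis unfolding rep_def by (rule LeastI)
qed

text \<open>Terms equal in \<open>H\<close> are equal to the same variables and so share the least
  one; conversely, a shared variable links them.\<close>

lemma m_eq_iff:
  assumes "wf_tm \<Sigma>0 s" "wf_tm \<Sigma>0 t"
  shows "m s = m t \<longleftrightarrow> Eq s t \<in> H"
proof
  assume "m s = m t"
  then have "rep s = rep t" using inj_e by (simp add: m_def inj_eq)
  then show "Eq s t \<in> H" using Eq_rep[OF assms(1)] Eq_rep[OF assms(2)] Eq_trans Eq_sym by metis
next
  assume "Eq s t \<in> H"
  then have "Eq s (Var n) \<in> H \<longleftrightarrow> Eq t (Var n) \<in> H" for n using Eq_trans Eq_sym by blast
  then show "m s = m t" by (simp add: m_def rep_def)
qed

lemma m_cong: "Eq s t \<in> H \<Longrightarrow> m s = m t"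
  using m_eq_iff[of s t] H_wf[of "Eq s t"] by simp

lemma m_rep: "wf_tm \<Sigma>0 t \<Longrightarrow> m (Var (rep t)) = m t"
  using m_eq_iff[of t "Var (rep t)"] Eq_rep[of t] by simp

lemma m_carrier: "wf_tm \<Sigma>0 t \<Longrightarrow> m t \<in> range (\<lambda>n. m (Var n))"
  using m_rep by (metis rangeI)

text \<open>\<open>ext\<close> mentions variables only; Leibniz's law carries membership over to
  every term and makes it independent of the chosen name.\<close>

lemma m_in_ext: 
  assumes "wf_tm \<Sigma>0 s"
  shows "m s \<in> ext \<psi> \<longleftrightarrow> inst \<psi> s \<in> H"
proof
  assume "m s \<in> ext \<psi>"
  then obtain n where n: "m s = m (Var n)" "inst \<psi> (Var n) \<in> H" by (auto simp: ext_def)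
  then have "Eq (Var n) s \<in> H" using m_eq_iff[of "Var n" s] assms by simp
  then show "inst \<psi> s \<in> H" using Eq_inst n(2) by blast
next
  assume "inst \<psi> s \<in> H"
  then have "inst \<psi> (Var (rep s)) \<in> H" using Eq_inst Eq_rep[OF assms] by blast
  then show "m s \<in> ext \<psi>" unfolding ext_def using m_rep[OF assms, symmetric] by blast
qed

lemma list_Eq_rep: "\<forall>t\<in>set ts. wf_tm \<Sigma>0 t \<Longrightarrow> list_all2 (\<lambda>s t. Eq s t \<in> H) ts (map (\<lambda>t. Var (rep t)) ts)"
  by (auto simp: list_all2_conv_all_nth Eq_rep)

lemma eval_M:
  assumes "wf_tm \<Sigma>0 t" "\<And>n. wf_tm \<Sigma>0 (\<theta> n)"
  shows "eval M (\<lambda>n. m (\<theta> n)) t = m (subst_tm \<theta> t)"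
  using assms(1)
proof (induct t)
  case (Fun f ts)
  let ?ts = "map (subst_tm \<theta>) ts"
  have wf: "wf_tm \<Sigma>0 (Fun f ?ts)" using Fun(2) assms(2) by (auto intro: wf_tm_subst)
  have "map (eval M (\<lambda>n. m (\<theta> n))) ts = map m ?ts" using Fun by auto
  then have "eval M (\<lambda>n. m (\<theta> n)) (Fun f ts) = m (Fun f (map (\<lambda>t. Var (rep t)) ?ts))"
    using Fun(2) by (simp add: inv_m o_def del: map_eq_conv)
  \<comment> \<open>Evaluation sees only the names of the arguments; congruence puts the arguments
    themselves back.\<close>
  also have "\<dots> = m (Fun f ?ts)"
  proof -
    have "Eq (Fun f ?ts) (Fun f (map (\<lambda>t. Var (rep t)) ?ts)) \<in> H"
      by (rule Fun_list[OF list_Eq_rep wf]) (use wf in auto)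
    then show ?thesis by (rule m_cong[symmetric])
  qed
  finally show ?case by simp
qed simp

lemma case_nat_m: "case_nat (m s) (\<lambda>n. m (\<theta> n)) = (\<lambda>n. m (case_nat s \<theta> n))"
  by (auto split: nat.split)

text \<open>The substitution names the valuation, which keeps the statement inductive: passing a
  binder extends both by the same term.\<close>

lemma truth:
  assumes "wf_fm \<Sigma>0 \<phi>" "\<And>n. wf_tm \<Sigma>0 (\<theta> n)"
  shows "sat M (\<lambda>n. m (\<theta> n)) \<phi> \<longleftrightarrow> subst \<theta> \<phi> \<in> H"
  using assms
proof (induct \<phi> arbitrary: \<theta>)
  case (Eq s t)
  then show ?case by (simp add: eval_M m_eq_iff wf_tm_subst)
next
  case (Pred p ts)
  let ?ts = "map (subst_tm \<theta>) ts"
  have wf: "\<forall>t\<in>set ?ts. wf_tm \<Sigma>0 t" using Pred by (auto intro: wf_tm_subst)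
  have "map (eval M (\<lambda>n. m (\<theta> n))) ts = map m ?ts" using Pred by (auto intro: eval_M)
  then have "sat M (\<lambda>n. m (\<theta> n)) (Pred p ts) \<longleftrightarrow> Pred p (map (\<lambda>t. Var (rep t)) ?ts) \<in> H"
    using Pred(1) by (simp add: inv_m o_def del: map_eq_conv)
  also have "\<dots> \<longleftrightarrow> Pred p ?ts \<in> H"
  proof -
    note eqs = list_Eq_rep[OF wf]
    then have "list_all2 (\<lambda>s t. Eq s t \<in> H) (map (\<lambda>t. Var (rep t)) ?ts) ?ts"
      by (auto simp: list_all2_conv_all_nth intro: Eq_sym)
    then show ?thesis using eqs Pred_list by blast
  qed
  finally show ?case by simp
next
  case (Neg \<phi>)
  then show ?case by (simp add: Neg_iff wf_fm_subst)
next
  case (Con \<phi> \<psi>)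
  then show ?case by (simp add: Con_iff wf_fm_subst)
next
  case (Dis \<phi> \<psi>)
  then show ?case by (simp add: Dis_iff wf_fm_subst)
next
  case (Imp \<phi> \<psi>)
  then show ?case by (simp add: Imp_iff wf_fm_subst)
next
  case (Uni \<phi>)
  have "sat M (case_nat (m (Var y)) (\<lambda>n. m (\<theta> n))) \<phi> \<longleftrightarrow> inst (subst (up \<theta>) \<phi>) (Var y) \<in> H" for y
    unfolding case_nat_m inst_subst_up by (rule Uni) (use Uni in \<open>auto split: nat.split\<close>)
  moreover have "wf_fm \<Sigma>0 (subst (up \<theta>) \<phi>)" using Uni by (auto intro!: wf_fm_subst wf_tm_up)
  ultimately show ?case by (simp add: Uni_iff)
next
  case (Exi \<phi>)
  have "sat M (case_nat (m (Var y)) (\<lambda>n. m (\<theta> n))) \<phi> \<longleftrightarrow> inst (subst (up \<theta>) \<phi>) (Var y) \<in> H" for y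
    unfolding case_nat_m inst_subst_up by (rule Exi) (use Exi in \<open>auto split: nat.split\<close>)
  moreover have "wf_fm \<Sigma>0 (subst (up \<theta>) \<phi>)" using Exi by (auto intro!: wf_fm_subst wf_tm_up)
  ultimately show ?case by (simp add: Exi_iff)
next
  case (RTC \<phi> s t)
  define \<phi>' s' t' where "\<phi>' = subst (up (up \<theta>)) \<phi>" and "s' = subst_tm \<theta> s" and "t' = subst_tm \<theta> t"
  have wf: "wf_fm \<Sigma>0 \<phi>'" "wf_tm \<Sigma>0 s'" "wf_tm \<Sigma>0 t'"
    using RTC by (auto simp: \<phi>'_def s'_def t'_def intro!: wf_fm_subst wf_tm_up wf_tm_subst)
  have ev: "eval M (\<lambda>n. m (\<theta> n)) s = m s'" "eval M (\<lambda>n. m (\<theta> n)) t = m t'"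
    using RTC by (simp_all add: eval_M s'_def t'_def)
  have body: "sat M (case_nat (m (Var i)) (case_nat (m (Var j)) (\<lambda>n. m (\<theta> n)))) \<phi>
      \<longleftrightarrow> inst2 \<phi>' (Var i) (Var j) \<in> H" for i j
    unfolding case_nat_m \<phi>'_def inst2_subst_up
    by (rule RTC) (use RTC in \<open>auto split: nat.split\<close>)
  \<comment> \<open>Admissible sets have the form \<open>ext \<psi>\<close>, and membership in them
    is membership in \<open>H\<close>; the semantic clause becomes induction for all schemas
    \<open>\<psi>\<close>.\<close>
  have "sat M (\<lambda>n. m (\<theta> n)) (RTC \<phi> s t) \<longleftrightarrow>
    (\<forall>\<psi>. wf_fm \<Sigma>0 \<psi> \<longrightarrow> inst \<psi> s' \<in> H \<longrightarrow>
      (\<forall>i j. inst \<psi> (Var i) \<in> H \<longrightarrow> inst2 \<phi>' (Var i) (Var j) \<in> H \<longrightarrow> inst \<psi> (Var j) \<in> H) \<longrightarrow>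
      inst \<psi> t' \<in> H)"
    using m_in_ext[of "Var _"] m_in_ext[OF wf(2)] m_in_ext[OF wf(3)]
    by (auto simp: ev body)
  also have "\<dots> \<longleftrightarrow> RTC \<phi>' s' t' \<in> H"
  proof
    assume "RTC \<phi>' s' t' \<in> H"
    then show "\<forall>\<psi>. wf_fm \<Sigma>0 \<psi> \<longrightarrow> inst \<psi> s' \<in> H \<longrightarrow>
      (\<forall>i j. inst \<psi> (Var i) \<in> H \<longrightarrow> inst2 \<phi>' (Var i) (Var j) \<in> H \<longrightarrow> inst \<psi> (Var j) \<in> H) \<longrightarrow>
      inst \<psi> t' \<in> H"
      using RTC_induct by blast
  next
    assume all: "\<forall>\<psi>. wf_fm \<Sigma>0 \<psi> \<longrightarrow> inst \<psi> s' \<in> H \<longrightarrow>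
      (\<forall>i j. inst \<psi> (Var i) \<in> H \<longrightarrow> inst2 \<phi>' (Var i) (Var j) \<in> H \<longrightarrow> inst \<psi> (Var j) \<in> H) \<longrightarrow>
      inst \<psi> t' \<in> H"
    \<comment> \<open>The points reachable from \<open>s'\<close>: (Refl) puts \<open>s'\<close>
      among them and (Trans) closes them under \<open>\<phi>'\<close>, so the assumption puts
      \<open>t'\<close> among them, which is the formula wanted.\<close>
    define \<psi> where "\<psi> = RTC (subst (up (up (\<lambda>k. Var (Suc k)))) \<phi>') (lift s') (Var 0)"
    have inst_\<psi>: "inst \<psi> u = RTC \<phi>' s' u" for u
      by (simp add: \<psi>_def inst_def subst_subst subst_tm_up up_Var subst_Var)
    have "wf_fm \<Sigma>0 \<psi>"
      using wf wf_lift by (auto simp: \<psi>_def intro!: wf_fm_subst wf_tm_up)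
    moreover have "inst \<psi> s' \<in> H" using RTC_refl wf by (simp add: inst_\<psi>)
    moreover have "inst \<psi> (Var j) \<in> H" if "inst \<psi> (Var i) \<in> H" "inst2 \<phi>' (Var i) (Var j) \<in> H" for i j
      using RTC_step[of \<phi>' s' "Var i" "Var j"] that by (simp add: inst_\<psi>)
    ultimately have "inst \<psi> t' \<in> H" using all by blast
    then show "RTC \<phi>' s' t' \<in> H" by (simp add: inst_\<psi>)
  qed
  finally show ?case by (simp add: \<phi>'_def s'_def t'_def)
qed

section \<open>Symbols outside the small signature and admissibility of definable sets\<close>

lemma eval_erase: "v k = m (Var 0) \<Longrightarrow> eval M v (erase_tm \<Sigma>0 k t) = eval M v t"
proof (induct t)
  case (Fun f ts)
  then have "map (eval M v \<circ> erase_tm \<Sigma>0 k) ts = map (eval M v) ts" by auto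
  then show ?case using Fun by (simp del: map_eq_conv)
qed simp

lemma sat_erase: "v k = m (Var 0) \<Longrightarrow> sat M v (erase \<Sigma>0 k \<phi>) = sat M v \<phi>"
proof (induct \<phi> arbitrary: v k)
  case (Pred p ts)
  then have "map (eval M v \<circ> erase_tm \<Sigma>0 k) ts = map (eval M v) ts" by (auto simp: eval_erase)
  then show ?case using Pred by (simp del: map_eq_conv)
qed (simp_all add: eval_erase)

text \<open>A definable set is brought into the form \<open>ext \<psi>\<close>: erasure leads into
  \<open>\<Sigma>0\<close>, and the parameters in \<open>v\<close> are replaced by variables naming
  them.\<close>

lemma henkin_structure_M: "henkin_structure \<Sigma> M"
  unfolding henkin_structure_def
proof (intro conjI allI impI)
  show "is_frame \<Sigma> M"
    unfolding is_frame_def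
  proof (intro conjI)
    show "\<forall>(f, n)\<in>funs \<Sigma>. \<forall>as. length as = n \<and> set as \<subseteq> carrier M \<longrightarrow> fint M f as \<in> carrier M"
      by (auto intro!: m_carrier)
    show "admissible M \<subseteq> Pow (carrier M)" by (auto simp: ext_def)
  qed simp
next
  fix \<phi> :: "('f, 'p) fm" and x :: nat and v :: "nat \<Rightarrow> 'd"
  assume v: "valuation M v"
  \<comment> \<open>\<open>k\<close> is not free in \<open>\<phi>\<close> and differs from
    \<open>x\<close>, so it may be given the default element without affecting the set.\<close>
  obtain k where k: "k \<notin> insert x (fv \<phi>)" using fresh_nat[of "insert x (fv \<phi>)"] finite_fv by auto
  define \<rho> where "\<rho> n = (SOME i. v n = m (Var i))" for n
  have \<rho>: "v n = m (Var (\<rho> n))" for n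
  proof -
    have "\<exists>i. v n = m (Var i)" using v by (auto simp: valuation_def)
    then show ?thesis unfolding \<rho>_def by (rule someI_ex)
  qed
  define \<chi> where "\<chi> = erase \<Sigma>0 k \<phi>"
  define \<theta> where "\<theta> i = (\<lambda>n. if n = x then Var i else if n = k then Var 0 else Var (\<rho> n) :: 'f tm)" for i
  \<comment> \<open>Index 0 is the argument; instantiation turns \<open>Var 1\<close> into
    \<open>Var 0\<close>, the default element, and \<open>Var (Suc (\<rho> n))\<close> into the name
    of \<open>v n\<close>.\<close>
  define \<psi> where "\<psi> = subst (\<lambda>n. if n = x then Var 0 else if n = k then Var 1 else Var (Suc (\<rho> n))) \<chi>"
  have wf: "wf_fm \<Sigma>0 \<chi>" "wf_fm \<Sigma>0 \<psi>"
    by (auto simp: \<chi>_def \<psi>_def wf_erase intro!: wf_fm_subst)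
  have "sat M (v(x := m (Var i))) \<phi> \<longleftrightarrow> inst \<psi> (Var i) \<in> H" for i
  proof -
    have "sat M (v(x := m (Var i))) \<phi> = sat M (\<lambda>n. m (\<theta> i n)) \<phi>"
      by (rule sat_cong) (use k \<rho> in \<open>auto simp: \<theta>_def\<close>)
    also have "\<dots> = sat M (\<lambda>n. m (\<theta> i n)) \<chi>"
      unfolding \<chi>_def by (rule sat_erase[symmetric]) (use k in \<open>simp add: \<theta>_def\<close>)
    also have "\<dots> \<longleftrightarrow> subst (\<theta> i) \<chi> \<in> H" by (rule truth[OF wf(1)]) (simp add: \<theta>_def)
    also have "subst (\<theta> i) \<chi> = inst \<psi> (Var i)"
      unfolding inst_def \<psi>_def subst_subst by (rule subst_cong) (simp add: \<theta>_def)
    finally show ?thesis .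
  qed
  then have "{a \<in> carrier M. sat M (v(x := a)) \<phi>} = ext \<psi>"
    by (auto simp: ext_def)
  then show "{a \<in> carrier M. sat M (v(x := a)) \<phi>} \<in> admissible M" using wf(2) by auto
qed

end


section \<open>Completeness\<close>

instance tm :: (countable) countable
  by countable_datatype

instance fm :: (countable, countable) countable
  by countable_datatype

lemma wf_tm_symbols: "wf_tm \<Sigma> t \<Longrightarrow> set_tm t \<subseteq> fst ` funs \<Sigma>"
  by (induct t) (auto intro: rev_image_eqI)

lemma wf_fm_symbols:
  "wf_fm \<Sigma> \<phi> \<Longrightarrow> set1_fm \<phi> \<subseteq> fst ` funs \<Sigma> \<and> set2_fm \<phi> \<subseteq> fst ` preds \<Sigma>"
  by (induct \<phi>) (auto dest!: wf_tm_symbols intro: rev_image_eqI)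

lemma finite_set_tm: "finite (set_tm t)"
  by (induct t) auto

lemma finite_set_fm: "finite (set1_fm \<phi>)" "finite (set2_fm \<phi>)"
  by (induct \<phi>) (auto simp: finite_set_tm)

text \<open>Each such formula arises by decoding the symbols of a formula over numbers, and there
  are countably many of those.\<close>

lemma countable_wf_fm:
  assumes "countable (fst ` funs \<Sigma>)" "countable (fst ` preds \<Sigma>)"
  shows "countable {\<phi>. wf_fm \<Sigma> \<phi>}"
proof -
  let ?A = "fst ` funs \<Sigma>" and ?B = "fst ` preds \<Sigma>"
  have "\<phi> \<in> range (map_fm (from_nat_into ?A) (from_nat_into ?B))" if "wf_fm \<Sigma> \<phi>" for \<phi>
  proof -
    have symbols: "\<And>f. f \<in> set1_fm \<phi> \<Longrightarrow> f \<in> ?A" "\<And>p. p \<in> set2_fm \<phi> \<Longrightarrow> p \<in> ?B"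
      using wf_fm_symbols[OF that] by blast+
    have "map_fm (from_nat_into ?A) (from_nat_into ?B) (map_fm (to_nat_on ?A) (to_nat_on ?B) \<phi>) = \<phi>"
      unfolding fm.map_comp
      by (rule fm.map_ident_strong) (simp_all only: o_apply from_nat_into_to_nat_on assms symbols)
    then show ?thesis by (metis rangeI)
  qed
  then have "{\<phi>. wf_fm \<Sigma> \<phi>} \<subseteq> range (map_fm (from_nat_into ?A) (from_nat_into ?B))" by auto
  then show ?thesis by (rule countable_subset) simp
qed

definition restrict_sig :: "'f set \<Rightarrow> 'p set \<Rightarrow> ('f, 'p) signature \<Rightarrow> ('f, 'p) signature" where
  "restrict_sig A B \<Sigma> = \<lparr>funs = {(f, n) \<in> funs \<Sigma>. f \<in> A}, preds = {(p, n) \<in> preds \<Sigma>. p \<in> B}\<rparr>"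

lemma restrict_sig_simps [simp]:
  "funs (restrict_sig A B \<Sigma>) = {(f, n) \<in> funs \<Sigma>. f \<in> A}"
  "preds (restrict_sig A B \<Sigma>) = {(p, n) \<in> preds \<Sigma>. p \<in> B}"
  by (simp_all add: restrict_sig_def)

lemma wf_tm_restrict: "wf_tm \<Sigma> t \<Longrightarrow> set_tm t \<subseteq> A \<Longrightarrow> wf_tm (restrict_sig A B \<Sigma>) t"
  by (induct t) auto

lemma wf_fm_restrict:
  "wf_fm \<Sigma> \<phi> \<Longrightarrow> set1_fm \<phi> \<subseteq> A \<Longrightarrow> set2_fm \<phi> \<subseteq> B \<Longrightarrow> wf_fm (restrict_sig A B \<Sigma>) \<phi>"
  by (induct \<phi>) (auto intro!: wf_tm_restrict)

text \<open>Contrapositive: the canonical structure of an underivable sequent, placed inside the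
  infinite type \<open>'d\<close>, is a countermodel.\<close>

lemma RTC_G_complete:
  fixes \<Sigma> :: "('f, 'p) signature"
  assumes inf: "infinite (UNIV :: 'd set)" and wf: "wf_seq \<Sigma> S"
    and valid: "henkin_valid TYPE('d) \<Sigma> S"
  shows "RTC_G \<Sigma> S"
proof (rule ccontr)
  assume unprov: "\<not> RTC_G \<Sigma> S"
  obtain \<Gamma> \<Delta> where S: "S = (\<Gamma> \<turnstile> \<Delta>)" by (cases S)
  have fin: "finite \<Gamma>" "finite \<Delta>" using wf S by auto
  \<comment> \<open>The sequent is finite, so keeping only its symbols leaves countably many
    formulas, however large \<open>\<Sigma>\<close> is.\<close>
  define A B where "A = (\<Union>\<phi>\<in>\<Gamma> \<union> \<Delta>. set1_fm \<phi>)" and "B = (\<Union>\<phi>\<in>\<Gamma> \<union> \<Delta>. set2_fm \<phi>)"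
  define \<Sigma>0 where "\<Sigma>0 = restrict_sig A B \<Sigma>"
  have AB: "countable A" "countable B"
    using fin by (auto simp: A_def B_def finite_set_fm intro!: countable_finite)
  have "fst ` funs \<Sigma>0 \<subseteq> A" "fst ` preds \<Sigma>0 \<subseteq> B" by (auto simp: \<Sigma>0_def)
  then have cnt: "countable {\<phi>. wf_fm \<Sigma>0 \<phi>}"
    by (intro countable_wf_fm) (rule countable_subset, assumption, rule AB)+
  have sub: "funs \<Sigma>0 \<subseteq> funs \<Sigma>" "preds \<Sigma>0 \<subseteq> preds \<Sigma>" by (auto simp: \<Sigma>0_def)
  have wf_small: "\<forall>\<phi>\<in>\<Gamma> \<union> \<Delta>. wf_fm \<Sigma>0 \<phi>"
  proof
    fix \<phi> assume "\<phi> \<in> \<Gamma> \<union> \<Delta>"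
    then show "wf_fm \<Sigma>0 \<phi>"
      unfolding \<Sigma>0_def using wf by (intro wf_fm_restrict) (auto simp: S A_def B_def)
  qed
  have "\<not> RTC_G \<Sigma> (Neg ` \<Delta> \<union> \<Gamma> \<turnstile> {})"
    using RTC_G_neg_image_inv[OF fin(2), of \<Sigma> \<Gamma> "{}"] unprov S by auto
  moreover have "\<forall>\<chi>\<in>Neg ` \<Delta> \<union> \<Gamma>. wf_fm \<Sigma>0 \<chi>" using wf_small by auto
  ultimately obtain H where H: "Neg ` \<Delta> \<union> \<Gamma> \<subseteq> H" "witnessed_set \<Sigma> \<Sigma>0 H"
    using witnessed_set_exists[OF cnt sub, of "Neg ` \<Delta> \<union> \<Gamma>"] fin by auto
  obtain e :: "nat \<Rightarrow> 'd" where e: "inj e" using infinite_countable_subset[OF inf] by blast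
  interpret canonical_model \<Sigma> \<Sigma>0 H e
    using H(2) e by (simp add: canonical_model_def canonical_model_axioms_def)
  \<comment> \<open>Each variable denotes its own class; by the truth lemma for \<open>Var\<close>,
    truth is membership in \<open>H\<close>, which contains \<open>\<Gamma>\<close> and the
    negations of \<open>\<Delta>\<close>.\<close>
  let ?v = "\<lambda>n. m (Var n)"
  have sat_iff: "sat M ?v \<phi> \<longleftrightarrow> \<phi> \<in> H" if "\<phi> \<in> \<Gamma> \<union> \<Delta>" for \<phi>
    using truth[of \<phi> Var] wf_small that by (simp add: subst_Var)
  have "valuation M ?v" by (auto simp: valuation_def)
  moreover have "\<forall>\<phi>\<in>\<Gamma>. sat M ?v \<phi>" using sat_iff H(1) by auto
  moreover have "\<exists>\<phi>\<in>\<Delta>. sat N v \<phi>"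
    if "henkin_structure \<Sigma> N" "valuation N v" "\<forall>\<phi>\<in>\<Gamma>. sat N v \<phi>"
    for N :: "('f, 'p, 'd) frame" and v
    using valid that unfolding henkin_valid_def S by auto
  ultimately obtain \<phi> where "\<phi> \<in> \<Delta>" "sat M ?v \<phi>"
    using henkin_structure_M by blast
  then show False using sat_iff[of \<phi>] H(1) Neg_iff[of \<phi>] wf_small by auto
qed

theorem theorem5:
  fixes \<Sigma> :: "('f, 'p) signature"
  shows "(\<forall>S. RTC_G \<Sigma> S \<longrightarrow> CRTC_omega_G \<Sigma> S) \<and>
    (infinite (UNIV :: 'd set) \<longrightarrow>
      (\<forall>S. wf_seq \<Sigma> S \<longrightarrow> henkin_valid TYPE('d) \<Sigma> S \<longrightarrow> CRTC_omega_G \<Sigma> S))"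
  using RTC_G_imp_CRTC RTC_G_complete by blast

end
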